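(* Let $(\Omega,\Sigma)$ be a standard Borel space, let $Q=BC\cap AC_\infty$, and let $Y$ be the $\|\cdot\|_\infty$-closure of $Q$ in $AC_\infty$. Let $\widetilde{\partial^+_{\emptyset}}:AC_\infty\to NA$ be a linear $\|\cdot\|_\infty$-continuous Milnor operator extending the Burkill-Cesari integral $\partial^+_{\emptyset}:Q\to NA$ (such an extension is known to exist). Then $\widetilde{\partial^+_{\emptyset}}$ is a Milnor semivalue on $Y$; that is, its restriction to $Y$ is both a Milnor operator and a semivalue on $Y$.
   Context: A game is a set function $\nu:\Sigma\to\mathbb{R}$ with $\nu(\emptyset)=0$; it is monotone if $\nu(A)\le\nu(B)$ whenever $A\subseteq B$. $NA$ is the space of (finite signed) nonatomic countably additive measures on $\Sigma$, and $NA^+$ its nonnegative elements. $BV$ is the space of games with $\sup\sum_i|\nu(S_i)-\nu(S_{i-1})|<\infty$ over all finite chains $\emptyset=S_0\subset\dots\subset S_m=\Omega$ in $\Sigma$. For games write $\nu\preceq\eta$ if $\eta-\nu$ is monotone. $AC_\infty$ (Lipschitz games) is the space of $\nu\in BV$ such that $-\mu\preceq\nu\preceq\mu$ for some $\mu\in NA^+$; it is a Banach space with the norm $\|\nu\|_\infty=\inf\{\mu(\Omega):\mu\in NA^+,\ -\mu\preceq\nu\preceq\mu\}$. Continuity of operators $AC_\infty\supseteq W\to NA$ is with respect to $\|\cdot\|_\infty$ on both sides. For $E\in\Sigma$, $\Pi(E)$ is the set of finite partitions of $E$ into disjoint elements of $\Sigma$. For $\lambda\in NA^+$ and $D\in\Pi(E)$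 put $\delta_\lambda(D)=\max\{\lambda(I):I\in D\}$. A game $\nu$ is $\delta_\lambda$-BC (Burkill-Cesari) integrable if for every $E\in\Sigma$ the finite limit $\partial^+_{\emptyset}(\nu,E):=\lim_{\delta_\lambda(D)\to0,\,D\in\Pi(E)}\sum_{I\in D}\nu(I)$ exists, i.e. for every $\varepsilon>0$ there is $\delta>0$ such that $|\sum_{I\in D}\nu(I)-\partial^+_{\emptyset}(\nu,E)|<\varepsilon$ for all $D\in\Pi(E)$ with $\delta_\lambda(D)<\delta$. $BC$ is the space of games that are $\delta_\lambda$-BC integrable for some $\lambda\in NA^+$; the integral is known not to depend on the choice of such $\lambda$. For $\nu\in AC_\infty$ let $D^\nu=\{\lambda\in NA:\nu\preceq\lambda\}$, $D_\nu=\{\lambda\in NA:\lambda\preceq\nu\}$, and let $\nu^*$ be the greatest lower bound of $D^\nu$ and $\nu_*$ the least upper bound of $D_\nu$ in $NA$ with the setwise order $\le$ (these exist). For a linear subspace $NA\subseteq W\subseteq AC_\infty$, a linear operator $\psi:W\to NA$ is a Milnor operator if $\nu_*\le\psi\nu\le\nu^*$ for every $\nu\in W$. $\mathcal G$ is the group of automorphisms of $(\Omega,\Sigma)$ (bijections of $\Omega$ measurable in both directions); for $\vartheta\in\mathcal G$, $(\vartheta_*\nu)(E)=\nu(\vartheta(E))$. A subspace of $BV$ is symmetric if it is invariant under every $\vartheta_*$. A semivalue on a symmetric subspace $W$ of $BV$ is a linear mapping $\varphi:W\to NA$ such that (symmetry) $\vartheta_*(\varphi(\nu))=\varphi(\vartheta_*\nu)$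 for all $\vartheta\in\mathcal G$, $\nu\in W$; (positivity) $\varphi(\nu)\ge0$ for every monotone $\nu\in W$; and $\varphi(\nu)=\nu$ for $\nu\in NA\cap W$. *)

theory Defs
  imports "HOL-Analysis.Analysis"
begin

text \<open>
  The measurable space \<open>(\<Omega>, \<Sigma>)\<close> is given by \<open>space M\<close> and \<open>sets M\<close> of a library measure \<open>M\<close>; the
  measure carried by \<open>M\<close> is never used.  A set function on \<open>\<Sigma>\<close> is a function \<open>'a set \<Rightarrow> real\<close> that
  vanishes outside \<open>sets M\<close>, so that equality of set functions is equality in HOL.
\<close>

definition standard_borel_space :: "'a measure \<Rightarrow> bool" where
  "standard_borel_space M \<longleftrightarrow>
     (\<exists>T. topspace T = space M \<and> completely_metrizable_space T \<and> separable_space T \<and>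
          sets M = sigma_sets (space M) {U. openin T U})"

definition games :: "'a measure \<Rightarrow> ('a set \<Rightarrow> real) set" where
  "games M = {\<nu>. \<nu> {} = 0 \<and> (\<forall>A. A \<notin> sets M \<longrightarrow> \<nu> A = 0)}"

definition monotone_game :: "'a measure \<Rightarrow> ('a set \<Rightarrow> real) \<Rightarrow> bool" where
  "monotone_game M \<nu> \<longleftrightarrow> (\<forall>A\<in>sets M. \<forall>B\<in>sets M. A \<subseteq> B \<longrightarrow> \<nu> A \<le> \<nu> B)"

definition game_le :: "'a measure \<Rightarrow> ('a set \<Rightarrow> real) \<Rightarrow> ('a set \<Rightarrow> real) \<Rightarrow> bool" where
  "game_le M \<nu> \<eta> \<longleftrightarrow> monotone_game M (\<lambda>A. \<eta> A - \<nu> A)"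

definition setwise_le :: "'a measure \<Rightarrow> ('a set \<Rightarrow> real) \<Rightarrow> ('a set \<Rightarrow> real) \<Rightarrow> bool" where
  "setwise_le M \<mu> \<kappa> \<longleftrightarrow> (\<forall>A\<in>sets M. \<mu> A \<le> \<kappa> A)"

definition countably_additive_game :: "'a measure \<Rightarrow> ('a set \<Rightarrow> real) \<Rightarrow> bool" where
  "countably_additive_game M \<mu> \<longleftrightarrow>
     (\<forall>A::nat \<Rightarrow> 'a set. range A \<subseteq> sets M \<longrightarrow> disjoint_family A \<longrightarrow> (\<lambda>n. \<mu> (A n)) sums \<mu> (\<Union>n. A n))"

text \<open>For a countably additive \<open>\<mu>\<close> these are exactly the atoms of its total variation.\<close>

definition game_atom :: "'a measure \<Rightarrow> ('a set \<Rightarrow> real) \<Rightarrow> 'a set \<Rightarrow> bool" where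
  "game_atom M \<mu> A \<longleftrightarrow>
     A \<in> sets M \<and> \<mu> A \<noteq> 0 \<and> (\<forall>B\<in>sets M. B \<subseteq> A \<longrightarrow> \<mu> B = 0 \<or> \<mu> (A - B) = 0)"

definition NA :: "'a measure \<Rightarrow> ('a set \<Rightarrow> real) set" where
  "NA M = {\<mu> \<in> games M. countably_additive_game M \<mu> \<and> (\<nexists>A. game_atom M \<mu> A)}"

definition NA_pos :: "'a measure \<Rightarrow> ('a set \<Rightarrow> real) set" where
  "NA_pos M = {\<mu> \<in> NA M. \<forall>A\<in>sets M. 0 \<le> \<mu> A}"

definition BV :: "'a measure \<Rightarrow> ('a set \<Rightarrow> real) set" where
  "BV M = {\<nu> \<in> games M. \<exists>C. \<forall>(m::nat) S.
     S 0 = {} \<longrightarrow> S m = space M \<longrightarrow> (\<forall>i\<le>m. S i \<in> sets M) \<longrightarrow> (\<forall>i<m. S i \<subseteq> S (Suc i)) \<longrightarrow>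
     (\<Sum>i<m. \<bar>\<nu> (S (Suc i)) - \<nu> (S i)\<bar>) \<le> C}"

definition lip_bound :: "'a measure \<Rightarrow> ('a set \<Rightarrow> real) \<Rightarrow> ('a set \<Rightarrow> real) \<Rightarrow> bool" where
  "lip_bound M \<mu> \<nu> \<longleftrightarrow> game_le M (\<lambda>A. - \<mu> A) \<nu> \<and> game_le M \<nu> \<mu>"

definition AC_inf :: "'a measure \<Rightarrow> ('a set \<Rightarrow> real) set" where
  "AC_inf M = {\<nu> \<in> BV M. \<exists>\<mu>\<in>NA_pos M. lip_bound M \<mu> \<nu>}"

definition norm_inf :: "'a measure \<Rightarrow> ('a set \<Rightarrow> real) \<Rightarrow> real" where
  "norm_inf M \<nu> = Inf {\<mu> (space M) |\<mu>. \<mu> \<in> NA_pos M \<and> lip_bound M \<mu> \<nu>}"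

definition norm_inf_closure ::
    "'a measure \<Rightarrow> ('a set \<Rightarrow> real) set \<Rightarrow> ('a set \<Rightarrow> real) set" where
  "norm_inf_closure M W =
     {\<nu> \<in> AC_inf M. \<forall>\<epsilon>>0. \<exists>\<eta>\<in>W. norm_inf M (\<lambda>A. \<nu> A - \<eta> A) < \<epsilon>}"

definition norm_inf_continuous_on ::
    "'a measure \<Rightarrow> ('a set \<Rightarrow> real) set \<Rightarrow> (('a set \<Rightarrow> real) \<Rightarrow> ('a set \<Rightarrow> real)) \<Rightarrow> bool" where
  "norm_inf_continuous_on M W \<psi> \<longleftrightarrow>
     (\<forall>\<nu>\<in>W. \<forall>\<epsilon>>0. \<exists>\<delta>>0. \<forall>\<eta>\<in>W. norm_inf M (\<lambda>A. \<eta> A - \<nu> A) < \<delta> \<longrightarrow>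
        norm_inf M (\<lambda>A. \<psi> \<eta> A - \<psi> \<nu> A) < \<epsilon>)"

definition finite_partitions :: "'a measure \<Rightarrow> 'a set \<Rightarrow> 'a set set set" where
  "finite_partitions M E = {D. finite D \<and> D \<subseteq> sets M \<and> partition_on E D}"

text \<open>
  \<open>partition_on\<close> excludes the empty set as a part, which affects neither the sums nor the mesh.
  For a nonnegative measure the inserted \<open>0\<close> only matters for the partition \<open>{}\<close> of the empty set.
\<close>

definition mesh :: "('a set \<Rightarrow> real) \<Rightarrow> 'a set set \<Rightarrow> real" where
  "mesh \<kappa> D = Max (insert 0 (\<kappa> ` D))"

definition has_BC_integral ::
    "'a measure \<Rightarrow> ('a set \<Rightarrow> real) \<Rightarrow> ('a set \<Rightarrow> real) \<Rightarrow> 'a set \<Rightarrow> real \<Rightarrow> bool" where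
  "has_BC_integral M \<kappa> \<nu> E l \<longleftrightarrow>
     (\<forall>\<epsilon>>0. \<exists>\<delta>>0. \<forall>D\<in>finite_partitions M E. mesh \<kappa> D < \<delta> \<longrightarrow> \<bar>(\<Sum>I\<in>D. \<nu> I) - l\<bar> < \<epsilon>)"

definition BC_integrable :: "'a measure \<Rightarrow> ('a set \<Rightarrow> real) \<Rightarrow> ('a set \<Rightarrow> real) \<Rightarrow> bool" where
  "BC_integrable M \<kappa> \<nu> \<longleftrightarrow> (\<forall>E\<in>sets M. \<exists>l. has_BC_integral M \<kappa> \<nu> E l)"

definition BC :: "'a measure \<Rightarrow> ('a set \<Rightarrow> real) set" where
  "BC M = {\<nu> \<in> games M. \<exists>\<kappa>\<in>NA_pos M. BC_integrable M \<kappa> \<nu>}"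

text \<open>
  For \<open>\<nu>\<close> in \<open>BC M\<close> the value does not depend on the choice of \<open>\<kappa>\<close>, so the description is definite.
\<close>

definition BC_integral :: "'a measure \<Rightarrow> ('a set \<Rightarrow> real) \<Rightarrow> ('a set \<Rightarrow> real)" where
  "BC_integral M \<nu> = (\<lambda>E. if E \<in> sets M
     then (THE l. \<exists>\<kappa>\<in>NA_pos M. BC_integrable M \<kappa> \<nu> \<and> has_BC_integral M \<kappa> \<nu> E l) else 0)"

definition upper_NA :: "'a measure \<Rightarrow> ('a set \<Rightarrow> real) \<Rightarrow> ('a set \<Rightarrow> real) set" where
  "upper_NA M \<nu> = {\<kappa> \<in> NA M. game_le M \<nu> \<kappa>}"

definition lower_NA :: "'a measure \<Rightarrow> ('a set \<Rightarrow> real) \<Rightarrow> ('a set \<Rightarrow> real) set" where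
  "lower_NA M \<nu> = {\<kappa> \<in> NA M. game_le M \<kappa> \<nu>}"

definition is_glb_NA :: "'a measure \<Rightarrow> ('a set \<Rightarrow> real) set \<Rightarrow> ('a set \<Rightarrow> real) \<Rightarrow> bool" where
  "is_glb_NA M D g \<longleftrightarrow> g \<in> NA M \<and> (\<forall>\<kappa>\<in>D. setwise_le M g \<kappa>) \<and>
     (\<forall>h\<in>NA M. (\<forall>\<kappa>\<in>D. setwise_le M h \<kappa>) \<longrightarrow> setwise_le M h g)"

definition is_lub_NA :: "'a measure \<Rightarrow> ('a set \<Rightarrow> real) set \<Rightarrow> ('a set \<Rightarrow> real) \<Rightarrow> bool" where
  "is_lub_NA M D g \<longleftrightarrow> g \<in> NA M \<and> (\<forall>\<kappa>\<in>D. setwise_le M \<kappa> g) \<and>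
     (\<forall>h\<in>NA M. (\<forall>\<kappa>\<in>D. setwise_le M \<kappa> h) \<longrightarrow> setwise_le M g h)"

text \<open>\<open>\<nu>\<^sup>*\<close> and \<open>\<nu>\<^sub>*\<close>; both bounds exist and are unique for \<open>\<nu>\<close> in \<open>AC_inf M\<close>.\<close>

definition upper_envelope :: "'a measure \<Rightarrow> ('a set \<Rightarrow> real) \<Rightarrow> ('a set \<Rightarrow> real)" where
  "upper_envelope M \<nu> = (THE g. is_glb_NA M (upper_NA M \<nu>) g)"

definition lower_envelope :: "'a measure \<Rightarrow> ('a set \<Rightarrow> real) \<Rightarrow> ('a set \<Rightarrow> real)" where
  "lower_envelope M \<nu> = (THE g. is_lub_NA M (lower_NA M \<nu>) g)"

definition game_subspace :: "('a set \<Rightarrow> real) set \<Rightarrow> bool" where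
  "game_subspace W \<longleftrightarrow> (\<lambda>A. 0) \<in> W \<and>
     (\<forall>\<nu>\<in>W. \<forall>\<eta>\<in>W. (\<lambda>A. \<nu> A + \<eta> A) \<in> W) \<and> (\<forall>c. \<forall>\<nu>\<in>W. (\<lambda>A. c * \<nu> A) \<in> W)"

definition linear_into_NA ::
    "'a measure \<Rightarrow> ('a set \<Rightarrow> real) set \<Rightarrow> (('a set \<Rightarrow> real) \<Rightarrow> ('a set \<Rightarrow> real)) \<Rightarrow> bool" where
  "linear_into_NA M W \<psi> \<longleftrightarrow> (\<forall>\<nu>\<in>W. \<psi> \<nu> \<in> NA M) \<and>
     (\<forall>\<nu>\<in>W. \<forall>\<eta>\<in>W. \<psi> (\<lambda>A. \<nu> A + \<eta> A) = (\<lambda>A. \<psi> \<nu> A + \<psi> \<eta> A)) \<and>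
     (\<forall>c. \<forall>\<nu>\<in>W. \<psi> (\<lambda>A. c * \<nu> A) = (\<lambda>A. c * \<psi> \<nu> A))"

text \<open>
  In the two notions below \<open>\<psi>\<close> is only constrained on \<open>W\<close>, so they speak about the restriction of
  \<open>\<psi>\<close> to \<open>W\<close>.
\<close>

definition milnor_operator ::
    "'a measure \<Rightarrow> ('a set \<Rightarrow> real) set \<Rightarrow> (('a set \<Rightarrow> real) \<Rightarrow> ('a set \<Rightarrow> real)) \<Rightarrow> bool" where
  "milnor_operator M W \<psi> \<longleftrightarrow>
     game_subspace W \<and> NA M \<subseteq> W \<and> W \<subseteq> AC_inf M \<and> linear_into_NA M W \<psi> \<and>
     (\<forall>\<nu>\<in>W. setwise_le M (lower_envelope M \<nu>) (\<psi> \<nu>) \<and> setwise_le M (\<psi> \<nu>) (upper_envelope M \<nu>))"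

definition automorphisms :: "'a measure \<Rightarrow> ('a \<Rightarrow> 'a) set" where
  "automorphisms M = {\<theta>. bij_betw \<theta> (space M) (space M) \<and> \<theta> \<in> measurable M M \<and>
     the_inv_into (space M) \<theta> \<in> measurable M M}"

definition push_game :: "'a measure \<Rightarrow> ('a \<Rightarrow> 'a) \<Rightarrow> ('a set \<Rightarrow> real) \<Rightarrow> ('a set \<Rightarrow> real)" where
  "push_game M \<theta> \<nu> = (\<lambda>E. if E \<in> sets M then \<nu> (\<theta> ` E) else 0)"

definition symmetric_subspace :: "'a measure \<Rightarrow> ('a set \<Rightarrow> real) set \<Rightarrow> bool" where
  "symmetric_subspace M W \<longleftrightarrow> game_subspace W \<and> W \<subseteq> BV M \<and>
     (\<forall>\<theta>\<in>automorphisms M. \<forall>\<nu>\<in>W. push_game M \<theta> \<nu> \<in> W)"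

definition semivalue ::
    "'a measure \<Rightarrow> ('a set \<Rightarrow> real) set \<Rightarrow> (('a set \<Rightarrow> real) \<Rightarrow> ('a set \<Rightarrow> real)) \<Rightarrow> bool" where
  "semivalue M W \<phi> \<longleftrightarrow> symmetric_subspace M W \<and> linear_into_NA M W \<phi> \<and>
     (\<forall>\<theta>\<in>automorphisms M. \<forall>\<nu>\<in>W. push_game M \<theta> (\<phi> \<nu>) = \<phi> (push_game M \<theta> \<nu>)) \<and>
     (\<forall>\<nu>\<in>W. monotone_game M \<nu> \<longrightarrow> (\<forall>A\<in>sets M. 0 \<le> \<phi> \<nu> A)) \<and>
     (\<forall>\<nu>\<in>NA M \<inter> W. \<phi> \<nu> = \<nu>)"

end

theory Submission
  imports Defs
begin

text \<open>
  Positivity and symmetry are checked on \<open>Q\<close>, where \<open>\<psi>\<close> is a limit of sums over fine partitions,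
  and then passed to the closure by continuity.  If \<open>\<nu>\<close> is monotone and \<open>\<eta> \<in> Q\<close> differs from \<open>\<nu>\<close>
  by less than \<open>\<epsilon>\<close> in norm, then \<open>\<eta> \<ge> - \<mu>\<close> on \<open>\<Sigma>\<close> for a measure \<open>\<mu>\<close> of mass less than \<open>\<epsilon>\<close>, so
  the integral of \<open>\<eta>\<close> is at least \<open>- \<epsilon>\<close>.  An automorphism carries partitions to partitions and
  measures to measures of the same mass, so it commutes with the integral and preserves the norm.
  The integral is well defined because a nonatomic measure has partitions of arbitrarily small mesh.
\<close>

section \<open>Fine partitions\<close>

text \<open>Small sets are first collected as overlapping covers, while a mesh is taken over
  partitions. Each new set contributes only what the earlier ones miss, so parts shrink and a
  nonnegative measure stays small on them.\<close>

lemma finite_cover_refined_by_partition: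
  assumes "finite D" "D \<subseteq> sets M"
  shows "\<exists>P. P \<in> finite_partitions M (\<Union>D) \<and> (\<forall>I\<in>P. \<exists>J\<in>D. I \<subseteq> J)"
  using assms
proof (induction D rule: finite_induct)
  case empty
  show ?case by (auto simp: finite_partitions_def partition_on_def)
next
  case (insert I D)
  then obtain P where P: "P \<in> finite_partitions M (\<Union>D)" "\<forall>I\<in>P. \<exists>J\<in>D. I \<subseteq> J"
    by auto
  have "\<Union>D \<in> sets M" using insert by (intro sets.finite_Union) auto
  then have m: "I - \<Union>D \<in> sets M" using insert by auto
  \<comment> \<open>The case split is forced because \<open>partition_on\<close> forbids an empty
    part.\<close>
  define P' where "P' = (if I \<subseteq> \<Union>D then P else insert (I - \<Union>D) P)"
  have UP: "\<Union>P = \<Union>D" using P by (auto simp: finite_partitions_def partition_on_def)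
  have "partition_on (\<Union>(insert I D)) P'"
  proof (rule partition_onI)
    show "\<Union>P' = \<Union>(insert I D)" using UP unfolding P'_def by auto
    show "{} \<notin> P'"
      using P unfolding P'_def finite_partitions_def partition_on_def
      by (auto split: if_splits)
    show "disjnt p q" if "p \<in> P'" "q \<in> P'" "p \<noteq> q" for p q
    proof -
      have dP: "disjnt p q" if "p \<in> P" "q \<in> P" "p \<noteq> q" for p q
        using that P by (auto simp: finite_partitions_def partition_on_def disjoint_def disjnt_def)
      have dI: "disjnt (I - \<Union>D) q" if "q \<in> P" for q
        using that UP by (auto simp: disjnt_def)
      show ?thesis
        using that dP dI unfolding P'_def by (auto split: if_splits simp: disjnt_sym)
    qed
  qed
  then have "P' \<in> finite_partitions M (\<Union>(insert I D))"
    using P m by (auto simp: P'_def finite_partitions_def)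
  moreover have "\<forall>I'\<in>P'. \<exists>J\<in>insert I D. I' \<subseteq> J"
    using P(2) unfolding P'_def by (auto split: if_splits)
  ultimately show ?case by blast
qed

text \<open>A proper cut leaves two pieces of positive measure, and one of them has at most half the
  mass. Iterating the halving beats any \<delta>.\<close>

lemma (in finite_measure) small_subset:
  assumes na: "\<And>A. A \<in> sets M \<Longrightarrow> 0 < measure M A \<Longrightarrow>
      \<exists>B\<in>sets M. B \<subseteq> A \<and> 0 < measure M B \<and> measure M B < measure M A"
    and A: "A \<in> sets M" "0 < measure M A" and "0 < \<delta>"
  shows "\<exists>B\<in>sets M. B \<subseteq> A \<and> 0 < measure M B \<and> measure M B < \<delta>"
proof -
  have halve: "\<exists>B\<in>sets M. B \<subseteq> A \<and> 0 < measure M B \<and> measure M B \<le> measure M A / 2"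
    if A: "A \<in> sets M" "0 < measure M A" for A
  proof -
    obtain B where B: "B \<in> sets M" "B \<subseteq> A" "0 < measure M B" "measure M B < measure M A"
      using na[OF A] by auto
    have d: "measure M (A - B) = measure M A - measure M B"
      using A B by (intro finite_measure_Diff)
    show ?thesis
    proof (cases "measure M B \<le> measure M A / 2")
      case False
      \<comment> \<open>The complement is now the lighter piece; the strict inequality in
        \<open>B(4)\<close> keeps its measure positive.\<close>
      then show ?thesis using A B d by (intro bexI[of _ "A - B"]) auto
    qed (use B in auto)
  qed
  have "\<exists>B\<in>sets M. B \<subseteq> A \<and> 0 < measure M B \<and> measure M B \<le> measure M A / 2 ^ n" for n
  proof (induction n)
    case (Suc n)
    then obtain B where B: "B \<in> sets M" "B \<subseteq> A" "0 < measure M B" "measure M B \<le> measure M A / 2 ^ n"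
      by auto
    obtain C where C: "C \<in> sets M" "C \<subseteq> B" "0 < measure M C" "measure M C \<le> measure M B / 2"
      using halve[OF B(1,3)] by auto
    have "measure M C \<le> measure M A / 2 ^ Suc n"
      using order_trans[OF C(4) divide_right_mono[OF B(4), of 2]] by (simp add: mult.commute)
    then show ?case using C B by (intro bexI[of _ C]) auto
  qed (use A in auto)
  moreover obtain n :: nat where "measure M A / \<delta> < 2 ^ n"
    using real_arch_pow[of 2] by auto
  then have "measure M A / 2 ^ n < \<delta>" using \<open>0 < \<delta>\<close> by (simp add: field_simps)
  ultimately show ?thesis by (meson le_less_trans)
qed

text \<open>Exhaustion: sets with a finite cover by small sets are closed under union. Good subsets
  of \<open>E\<close> whose measures approach the supremum fill \<open>E\<close> up to a null set,
  since otherwise a small piece of the rest could be added. A finite union then leaves a remainder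
  of measure below \<delta>, which is one more small set.\<close>

lemma (in finite_measure) finite_cover_small:
  assumes na: "\<And>A. A \<in> sets M \<Longrightarrow> 0 < measure M A \<Longrightarrow>
      \<exists>B\<in>sets M. B \<subseteq> A \<and> 0 < measure M B \<and> measure M B < measure M A"
    and E: "E \<in> sets M" and "0 < \<delta>"
  shows "\<exists>D. finite D \<and> D \<subseteq> sets M \<and> \<Union>D = E \<and> (\<forall>I\<in>D. measure M I < \<delta>)"
proof -
  define good where
    "good G \<longleftrightarrow> (\<exists>D. finite D \<and> D \<subseteq> sets M \<and> \<Union>D = G \<and> (\<forall>I\<in>D. measure M I < \<delta>))" for G
  have good_sets: "G \<in> sets M" if "good G" for G
    using that unfolding good_def by auto
  have good_Un: "good (G \<union> H)" if "good G" "good H" for G H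
  proof -
    obtain D1 where D1: "finite D1" "D1 \<subseteq> sets M" "\<Union>D1 = G" "\<forall>I\<in>D1. measure M I < \<delta>"
      using \<open>good G\<close> unfolding good_def by blast
    obtain D2 where D2: "finite D2" "D2 \<subseteq> sets M" "\<Union>D2 = H" "\<forall>I\<in>D2. measure M I < \<delta>"
      using \<open>good H\<close> unfolding good_def by blast
    show ?thesis unfolding good_def
      by (rule exI[of _ "D1 \<union> D2"]) (use D1 D2 in auto)
  qed
  have good_small: "good B" if "B \<in> sets M" "measure M B < \<delta>" for B
    using that unfolding good_def by (intro exI[of _ "{B}"]) auto
  define S where "S = measure M ` {G. good G \<and> G \<subseteq> E}"
  have "good {}" using \<open>0 < \<delta>\<close> by (intro good_small) auto
  then have ne: "S \<noteq> {}" unfolding S_def by auto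
  have bdd: "bdd_above S" unfolding S_def by (auto intro!: bdd_aboveI[of _ "measure M (space M)"] bounded_measure)
  have le: "measure M G \<le> Sup S" if "good G" "G \<subseteq> E" for G
    using that bdd unfolding S_def by (intro cSup_upper) auto
  \<comment> \<open>The slack \<open>1 / Suc n\<close> is later made smaller than the mass of the
    piece \<open>B\<close> found outside \<open>U\<close>.\<close>
  have "\<exists>G. good G \<and> G \<subseteq> E \<and> Sup S - 1 / Suc n < measure M G" for n
    using less_cSup_iff[OF ne bdd, of "Sup S - 1 / Suc n"] unfolding S_def by auto
  then obtain G where G: "\<And>n. good (G n)" "\<And>n. G n \<subseteq> E" "\<And>n. Sup S - 1 / Suc n < measure M (G n)"
    by metis
  define U where "U = (\<Union>n. G n)"
  have U: "U \<in> sets M" "U \<subseteq> E" using G good_sets unfolding U_def by auto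
  have "measure M (E - U) = 0"
  proof (rule ccontr)
    assume "measure M (E - U) \<noteq> 0"
    then have "0 < measure M (E - U)" by (simp add: zero_less_measure_iff)
    then obtain B where B: "B \<in> sets M" "B \<subseteq> E - U" "0 < measure M B" "measure M B < \<delta>"
      using small_subset[OF na, of "E - U" \<delta>] E U \<open>0 < \<delta>\<close> by auto
    obtain n where n: "1 / Suc n < measure M B"
      using B(3) nat_approx_posE by blast
    \<comment> \<open>\<open>B\<close> avoids \<open>U\<close> and hence \<open>G n\<close>, so
      adding it produces a good subset of \<open>E\<close> heavier than the supremum.\<close>
    have "measure M (G n) + measure M B = measure M (G n \<union> B)"
      using B good_sets[OF G(1)] by (intro finite_measure_Union[symmetric]) (auto simp: U_def)
    also have "\<dots> \<le> Sup S"
      using G B good_small[OF B(1,4)] by (intro le good_Un) auto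
    finally show False using G(3)[of n] n by linarith
  qed
  then have "measure M U = measure M E"
    using finite_measure_Diff[OF E U] by simp
  \<comment> \<open>The sets \<open>G n\<close> need not increase; continuity from below is applied
    to their finite unions.\<close>
  moreover have "(\<lambda>n. measure M (\<Union>i\<le>n. G i)) \<longlonglongrightarrow> measure M (\<Union>n. \<Union>i\<le>n. G i)"
    using G good_sets by (intro finite_Lim_measure_incseq) (auto simp: incseq_def, force)
  moreover have "(\<Union>n. \<Union>i\<le>n. G i) = U" unfolding U_def by auto
  ultimately have "(\<lambda>n. measure M (\<Union>i\<le>n. G i)) \<longlonglongrightarrow> measure M E" by simp
  then have "\<forall>\<^sub>F n in sequentially. measure M E - \<delta> < measure M (\<Union>i\<le>n. G i)"
    using \<open>0 < \<delta>\<close> by (intro order_tendstoD) auto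
  then obtain n where n: "measure M E - \<delta> < measure M (\<Union>i\<le>n. G i)"
    by (auto simp: eventually_sequentially)
  define H where "H = (\<Union>i\<le>n. G i)"
  have gH: "good (\<Union>i\<le>k. G i)" for k
    by (induction k) (auto simp: atMost_Suc G intro!: good_Un)
  then have H: "good H" unfolding H_def by auto
  have HE: "H \<subseteq> E" using G unfolding H_def by auto
  have "good (E - H)"
    using n good_sets[OF H] E finite_measure_Diff[OF E good_sets[OF H] HE]
    by (intro good_small) (auto simp: H_def)
  then have "good (H \<union> (E - H))" using H by (intro good_Un)
  then have "good E" using HE by (simp add: Un_absorb1)
  then show ?thesis unfolding good_def .
qed

section \<open>Nonatomic measures\<close>

lemma NA_empty: "\<mu> \<in> NA M \<Longrightarrow> \<mu> {} = 0"
  and NA_outside: "\<mu> \<in> NA M \<Longrightarrow> A \<notin> sets M \<Longrightarrow> \<mu> A = 0"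
  by (auto simp: NA_def games_def)

lemma NA_Un:
  assumes "\<mu> \<in> NA M" "A \<in> sets M" "B \<in> sets M" "A \<inter> B = {}"
  shows "\<mu> (A \<union> B) = \<mu> A + \<mu> B"
proof -
  have "(\<lambda>n. \<mu> (binaryset A B n)) sums \<mu> (\<Union>n. binaryset A B n)"
  proof -
    have "range (binaryset A B) \<subseteq> sets M" using assms by (auto simp: range_binaryset_eq)
    moreover have "disjoint_family (binaryset A B)"
      using assms(4) by (auto simp: disjoint_family_on_def binaryset_def)
    ultimately show ?thesis using assms(1) by (auto simp: NA_def countably_additive_game_def)
  qed
  moreover have "(\<lambda>n. \<mu> (binaryset A B n)) sums (\<mu> A + \<mu> B)"
    using binaryset_sums[of \<mu> A B] NA_empty[OF assms(1)] by simp
  ultimately show ?thesis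
    by (metis UN_binaryset_eq sums_unique2)
qed

lemma NA_sum_partition:
  assumes "\<mu> \<in> NA M" "D \<in> finite_partitions M E"
  shows "(\<Sum>I\<in>D. \<mu> I) = \<mu> E"
proof -
  have "(\<Sum>I\<in>D. \<mu> I) = \<mu> (\<Union>D)" if "finite D" "D \<subseteq> sets M" "disjoint D" for D
    using that
  proof (induction D rule: finite_induct)
    case (insert I D)
    have "\<mu> (I \<union> \<Union>D) = \<mu> I + \<mu> (\<Union>D)"
      using insert by (intro NA_Un[OF assms(1)] sets.finite_Union) (auto simp: disjoint_def)
    moreover have "disjoint D" using insert by (auto simp: disjoint_def)
    ultimately show ?case using insert by auto
  qed (use NA_empty[OF assms(1)] in auto)
  then show ?thesis using assms(2) by (auto simp: finite_partitions_def partition_on_def)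
qed

lemma NA_pos_NA: "\<mu> \<in> NA_pos M \<Longrightarrow> \<mu> \<in> NA M"
  and NA_pos_nonneg: "\<mu> \<in> NA_pos M \<Longrightarrow> 0 \<le> \<mu> A"
  using NA_outside[of \<mu> M A] by (auto simp: NA_pos_def)

lemma NA_Diff:
  assumes "\<mu> \<in> NA M" "A \<in> sets M" "B \<in> sets M" "A \<subseteq> B"
  shows "\<mu> (B - A) = \<mu> B - \<mu> A"
  using NA_Un[OF assms(1,2), of "B - A"] assms by (simp add: Un_absorb1)

lemma NA_pos_mono:
  assumes "\<mu> \<in> NA_pos M" "A \<in> sets M" "B \<in> sets M" "A \<subseteq> B"
  shows "\<mu> A \<le> \<mu> B"
  using NA_Diff[OF NA_pos_NA[OF assms(1)] assms(2-4)] NA_pos_nonneg[OF assms(1), of "B - A"] by simp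

lemma NA_pos_le_space: "\<mu> \<in> NA_pos M \<Longrightarrow> A \<in> sets M \<Longrightarrow> \<mu> A \<le> \<mu> (space M)"
  by (intro NA_pos_mono sets.sets_into_space) auto

lemma NA_pos_zero: "(\<lambda>A. 0) \<in> NA_pos M"
  by (auto simp: NA_pos_def NA_def games_def countably_additive_game_def game_atom_def)

text \<open>On a candidate atom some summand is nonzero, and that summand has a cut with both halves
  nonzero. Nonnegativity excludes cancellation with the other summand, so the same cut splits the
  sum.\<close>

lemma NA_pos_add:
  assumes "\<mu> \<in> NA_pos M" "\<kappa> \<in> NA_pos M"
  shows "(\<lambda>A. \<mu> A + \<kappa> A) \<in> NA_pos M"
proof -
  have "\<not> game_atom M (\<lambda>A. \<mu> A + \<kappa> A) A" for A
  proof
    assume at: "game_atom M (\<lambda>A. \<mu> A + \<kappa> A) A"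
    then have A: "A \<in> sets M" "\<mu> A \<noteq> 0 \<or> \<kappa> A \<noteq> 0" by (auto simp: game_atom_def)
    have "\<not> game_atom M \<mu> A" "\<not> game_atom M \<kappa> A"
      using assms by (auto simp: NA_pos_def NA_def)
    then obtain B where "B \<in> sets M" "B \<subseteq> A"
      "\<mu> B \<noteq> 0 \<and> \<mu> (A - B) \<noteq> 0 \<or> \<kappa> B \<noteq> 0 \<and> \<kappa> (A - B) \<noteq> 0"
      using A unfolding game_atom_def by blast
    then show False
      using at NA_pos_nonneg[OF assms(1), of B] NA_pos_nonneg[OF assms(1), of "A - B"]
        NA_pos_nonneg[OF assms(2), of B] NA_pos_nonneg[OF assms(2), of "A - B"]
      unfolding game_atom_def by (smt (verit))
  qed
  then show ?thesis
    using assms by (auto simp: NA_pos_def NA_def games_def countably_additive_game_def intro: sums_add)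
qed

lemma NA_pos_scale:
  assumes "\<mu> \<in> NA_pos M" "0 \<le> c"
  shows "(\<lambda>A. c * \<mu> A) \<in> NA_pos M"
proof -
  have "\<not> game_atom M (\<lambda>A. c * \<mu> A) A" for A
    using assms by (auto simp: NA_pos_def NA_def game_atom_def)
  then show ?thesis
    using assms by (auto simp: NA_pos_def NA_def games_def countably_additive_game_def intro: sums_mult)
qed

text \<open>This turns a nonnegative set function into a library measure, so that the exhaustion
  argument for \<open>finite_measure\<close> applies to it.\<close>

lemma NA_pos_finite_measure:
  assumes "\<mu> \<in> NA_pos M"
  obtains N where "finite_measure N" "sets N = sets M" "\<And>A. A \<in> sets M \<Longrightarrow> measure N A = \<mu> A"
proof -
  define N where "N = measure_of (space M) (sets M) (\<lambda>A. ennreal (\<mu> A))"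
  have sN: "sets N = sets M" "space N = space M" unfolding N_def by auto
  have em: "emeasure N A = ennreal (\<mu> A)" if "A \<in> sets M" for A
  proof (rule emeasure_measure_of_sigma[of "space M" "sets M" "\<lambda>A. ennreal (\<mu> A)", folded N_def])
    show "sigma_algebra (space M) (sets M)" by (rule sets.sigma_algebra_axioms)
    show "positive (sets M) (\<lambda>A. ennreal (\<mu> A))"
      using NA_empty[OF NA_pos_NA[OF assms]] by (simp add: positive_def)
    show "countably_additive (sets M) (\<lambda>A. ennreal (\<mu> A))"
    proof (rule countably_additiveI)
      fix A :: "nat \<Rightarrow> 'a set"
      assume A: "range A \<subseteq> sets M" "disjoint_family A"
      have "(\<lambda>n. \<mu> (A n)) sums \<mu> (\<Union>n. A n)"
        using A assms by (auto simp: NA_pos_def NA_def countably_additive_game_def)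
      then show "(\<Sum>n. ennreal (\<mu> (A n))) = ennreal (\<mu> (\<Union>n. A n))"
        using NA_pos_nonneg[OF assms]
        by (intro sums_unique[symmetric]) (simp add: sums_ennreal)
    qed
    show "A \<in> sets M" by fact
  qed
  have "finite_measure N" by (rule finite_measureI) (simp add: sN em)
  moreover have "measure N A = \<mu> A" if "A \<in> sets M" for A
    using em[OF that] NA_pos_nonneg[OF assms, of A] by (simp add: measure_def)
  ultimately show ?thesis using that sN by blast
qed

text \<open>Positivity of \<delta> takes care of the \<open>0\<close> inserted in
  \<open>mesh\<close>.\<close>

lemma mesh_less_iff:
  "finite D \<Longrightarrow> 0 < \<delta> \<Longrightarrow> mesh \<kappa> D < \<delta> \<longleftrightarrow> (\<forall>I\<in>D. \<kappa> I < \<delta>)"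
  by (auto simp: mesh_def)

text \<open>This keeps the limit defining the Burkill-Cesari integral from being vacuous. Exhaustion
  gives a cover by small sets, and disjointification gives the partition.\<close>

lemma NA_pos_fine_partition:
  assumes "\<kappa> \<in> NA_pos M" "E \<in> sets M" "0 < \<delta>"
  shows "\<exists>D\<in>finite_partitions M E. mesh \<kappa> D < \<delta>"
proof -
  obtain N where N: "finite_measure N" "sets N = sets M" "\<And>A. A \<in> sets M \<Longrightarrow> measure N A = \<kappa> A"
    using NA_pos_finite_measure[OF assms(1)] by metis
  interpret finite_measure N by fact
  \<comment> \<open>Failure of \<open>game_atom\<close> gives a cut with both halves nonzero; by
    nonnegativity each half is positive and strictly lighter than \<open>A\<close>.\<close>
  have "\<exists>B\<in>sets N. B \<subseteq> A \<and> 0 < measure N B \<and> measure N B < measure N A"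
    if A: "A \<in> sets N" "0 < measure N A" for A
  proof -
    have "\<not> game_atom M \<kappa> A" using assms(1) by (auto simp: NA_pos_def NA_def)
    then obtain B where B: "B \<in> sets M" "B \<subseteq> A" "\<kappa> B \<noteq> 0" "\<kappa> (A - B) \<noteq> 0"
      using A N unfolding game_atom_def by force
    then show ?thesis
      using A N NA_Diff[OF NA_pos_NA[OF assms(1)], of B A] NA_pos_nonneg[OF assms(1), of B]
        NA_pos_nonneg[OF assms(1), of "A - B"]
      by (intro bexI[of _ B]) auto
  qed
  then obtain D where D: "finite D" "D \<subseteq> sets M" "\<Union>D = E" "\<forall>I\<in>D. measure N I < \<delta>"
    using finite_cover_small[of E \<delta>] assms N by metis
  obtain P where P: "P \<in> finite_partitions M E" "\<forall>I\<in>P. \<exists>J\<in>D. I \<subseteq> J"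
    using finite_cover_refined_by_partition[OF D(1,2)] D(3) by auto
  have "\<kappa> I < \<delta>" if I: "I \<in> P" for I
  proof -
    obtain J where J: "J \<in> D" "I \<subseteq> J" using P(2) I by auto
    have "\<kappa> I \<le> \<kappa> J"
      using J I P D by (intro NA_pos_mono[OF assms(1)]) (auto simp: finite_partitions_def)
    also have "\<dots> < \<delta>" using D(2,4) N(3)[of J] J(1) by (metis subsetD)
    finally show ?thesis .
  qed
  then show ?thesis
    using P assms(3) by (intro bexI[of _ P]) (auto simp: mesh_less_iff finite_partitions_def)
qed

section \<open>The Burkill-Cesari integral\<close>

text \<open>A larger control measure leaves fewer fine partitions to test. Two games integrable for
  different control measures can thus be compared under the sum of the two.\<close>

lemma has_BC_integral_mono:
  assumes "has_BC_integral M \<kappa> \<nu> E l" "\<And>A. A \<in> sets M \<Longrightarrow> \<kappa> A \<le> \<kappa>' A"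
  shows "has_BC_integral M \<kappa>' \<nu> E l"
  unfolding has_BC_integral_def
proof (intro allI impI)
  fix \<epsilon> :: real assume "\<epsilon> > 0"
  then obtain \<delta> where \<delta>: "\<delta> > 0"
    "\<forall>D\<in>finite_partitions M E. mesh \<kappa> D < \<delta> \<longrightarrow> \<bar>(\<Sum>I\<in>D. \<nu> I) - l\<bar> < \<epsilon>"
    using assms(1) unfolding has_BC_integral_def by blast
  have "mesh \<kappa> D < \<delta>" if "D \<in> finite_partitions M E" "mesh \<kappa>' D < \<delta>" for D
    using that assms(2) \<delta>(1)
    by (auto simp: mesh_less_iff finite_partitions_def) (meson le_less_trans subsetD)
  then show "\<exists>\<delta>>0. \<forall>D\<in>finite_partitions M E. mesh \<kappa>' D < \<delta> \<longrightarrow> \<bar>(\<Sum>I\<in>D. \<nu> I) - l\<bar> < \<epsilon>"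
    using \<delta> by blast
qed

lemma has_BC_integral_add:
  assumes "has_BC_integral M \<kappa> \<nu> E l" "has_BC_integral M \<kappa> \<eta> E k"
  shows "has_BC_integral M \<kappa> (\<lambda>A. \<nu> A + \<eta> A) E (l + k)"
  unfolding has_BC_integral_def
proof (intro allI impI)
  fix \<epsilon> :: real assume "\<epsilon> > 0"
  then have e: "\<epsilon> / 2 > 0" by simp
  obtain \<delta>1 where 1: "\<delta>1 > 0"
    "\<forall>D\<in>finite_partitions M E. mesh \<kappa> D < \<delta>1 \<longrightarrow> \<bar>(\<Sum>I\<in>D. \<nu> I) - l\<bar> < \<epsilon> / 2"
    using assms(1) e unfolding has_BC_integral_def by blast
  obtain \<delta>2 where 2: "\<delta>2 > 0"
    "\<forall>D\<in>finite_partitions M E. mesh \<kappa> D < \<delta>2 \<longrightarrow> \<bar>(\<Sum>I\<in>D. \<eta> I) - k\<bar> < \<epsilon> / 2"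
    using assms(2) e unfolding has_BC_integral_def by blast
  show "\<exists>\<delta>>0. \<forall>D\<in>finite_partitions M E. mesh \<kappa> D < \<delta> \<longrightarrow>
      \<bar>(\<Sum>I\<in>D. \<nu> I + \<eta> I) - (l + k)\<bar> < \<epsilon>"
  proof (intro exI[of _ "min \<delta>1 \<delta>2"] conjI ballI impI)
    fix D assume "D \<in> finite_partitions M E" "mesh \<kappa> D < min \<delta>1 \<delta>2"
    then have "\<bar>(\<Sum>I\<in>D. \<nu> I) - l\<bar> < \<epsilon> / 2" "\<bar>(\<Sum>I\<in>D. \<eta> I) - k\<bar> < \<epsilon> / 2"
      using 1 2 by auto
    then show "\<bar>(\<Sum>I\<in>D. \<nu> I + \<eta> I) - (l + k)\<bar> < \<epsilon>"
      unfolding sum.distrib by linarith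
  qed (use 1 2 in auto)
qed

lemma has_BC_integral_scale:
  assumes "has_BC_integral M \<kappa> \<nu> E l"
  shows "has_BC_integral M \<kappa> (\<lambda>A. c * \<nu> A) E (c * l)"
  unfolding has_BC_integral_def
proof (intro allI impI)
  fix \<epsilon> :: real assume "\<epsilon> > 0"
  \<comment> \<open>The added 1 keeps the denominator positive when \<open>c\<close> is
    zero.\<close>
  then have "\<epsilon> / (\<bar>c\<bar> + 1) > 0" by simp
  then obtain \<delta> where \<delta>: "\<delta> > 0"
    "\<forall>D\<in>finite_partitions M E. mesh \<kappa> D < \<delta> \<longrightarrow> \<bar>(\<Sum>I\<in>D. \<nu> I) - l\<bar> < \<epsilon> / (\<bar>c\<bar> + 1)"
    using assms unfolding has_BC_integral_def by blast
  have "\<bar>(\<Sum>I\<in>D. c * \<nu> I) - c * l\<bar> < \<epsilon>"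
    if "\<bar>(\<Sum>I\<in>D. \<nu> I) - l\<bar> < \<epsilon> / (\<bar>c\<bar> + 1)" for D
  proof -
    have "\<bar>(\<Sum>I\<in>D. c * \<nu> I) - c * l\<bar> = \<bar>c\<bar> * \<bar>(\<Sum>I\<in>D. \<nu> I) - l\<bar>"
      by (simp add: sum_distrib_left[symmetric] abs_mult[symmetric] right_diff_distrib)
    also have "\<dots> \<le> (\<bar>c\<bar> + 1) * \<bar>(\<Sum>I\<in>D. \<nu> I) - l\<bar>" by (intro mult_right_mono) auto
    also have "\<dots> < \<epsilon>" using that by (simp add: field_simps)
    finally show ?thesis .
  qed
  then show "\<exists>\<delta>>0. \<forall>D\<in>finite_partitions M E. mesh \<kappa> D < \<delta> \<longrightarrow> \<bar>(\<Sum>I\<in>D. c * \<nu> I) - c * l\<bar> < \<epsilon>"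
    using \<delta> by blast
qed

text \<open>Nonatomicity of the control measure enters here: some partition is fine enough for its
  sum to lie within \<epsilon> of \<open>l\<close>.\<close>

lemma has_BC_integral_ge:
  assumes "has_BC_integral M \<kappa> \<nu> E l" "\<kappa> \<in> NA_pos M" "E \<in> sets M"
    and "\<And>D. D \<in> finite_partitions M E \<Longrightarrow> b \<le> (\<Sum>I\<in>D. \<nu> I)"
  shows "b \<le> l"
proof (rule field_le_epsilon)
  fix \<epsilon> :: real assume "\<epsilon> > 0"
  then obtain \<delta> where \<delta>: "\<delta> > 0"
    "\<forall>D\<in>finite_partitions M E. mesh \<kappa> D < \<delta> \<longrightarrow> \<bar>(\<Sum>I\<in>D. \<nu> I) - l\<bar> < \<epsilon>"
    using assms(1) unfolding has_BC_integral_def by blast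
  then obtain D where "D \<in> finite_partitions M E" "mesh \<kappa> D < \<delta>"
    using NA_pos_fine_partition[OF assms(2,3)] by blast
  then show "b \<le> l + \<epsilon>" using \<delta>(2) assms(4)[of D] by fastforce
qed

text \<open>Subtraction under the common control measure \<open>\<tau>\<close> makes both
  \<open>l - k\<close> and \<open>k - l\<close> limits for the zero game, whose partition sums are
  all 0, so both are nonnegative.\<close>

lemma has_BC_integral_unique:
  assumes "has_BC_integral M \<kappa> \<nu> E l" "has_BC_integral M \<kappa>' \<nu> E k"
    and "\<kappa> \<in> NA_pos M" "\<kappa>' \<in> NA_pos M" "E \<in> sets M"
  shows "l = k"
proof -
  define \<tau> where "\<tau> = (\<lambda>A. \<kappa> A + \<kappa>' A)"
  have "\<tau> \<in> NA_pos M" unfolding \<tau>_def using assms by (intro NA_pos_add)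
  have h: "has_BC_integral M \<tau> \<nu> E l" "has_BC_integral M \<tau> (\<lambda>A. - 1 * \<nu> A) E (- 1 * k)"
    by (intro has_BC_integral_scale has_BC_integral_mono[OF assms(1)] has_BC_integral_mono[OF assms(2)];
        simp add: \<tau>_def NA_pos_nonneg[OF assms(3)] NA_pos_nonneg[OF assms(4)])+
  have z: "has_BC_integral M \<tau> (\<lambda>A. 0) E (l - k)"
    using has_BC_integral_add[OF h] by simp
  moreover have "has_BC_integral M \<tau> (\<lambda>A. 0) E (k - l)"
    using has_BC_integral_scale[OF z, of "- 1"] by simp
  ultimately have "0 \<le> l - k" "0 \<le> k - l"
    using has_BC_integral_ge \<open>\<tau> \<in> NA_pos M\<close> assms(5) by fastforce+
  then show ?thesis by simp
qed

text \<open>The description in \<open>BC_integral\<close> ranges over all admissible control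
  measures; uniqueness across them lets any single limit determine the value.\<close>

lemma BC_integral_eqI:
  assumes "\<kappa> \<in> NA_pos M" "BC_integrable M \<kappa> \<nu>" "E \<in> sets M" "has_BC_integral M \<kappa> \<nu> E l"
  shows "BC_integral M \<nu> E = l"
  unfolding BC_integral_def using assms has_BC_integral_unique
  by (auto intro!: the_equality)

lemma BC_games: "\<nu> \<in> BC M \<Longrightarrow> \<nu> \<in> games M"
  by (simp add: BC_def)

lemma BC_obtain:
  assumes "\<nu> \<in> BC M"
  obtains \<kappa> where "\<kappa> \<in> NA_pos M" "BC_integrable M \<kappa> \<nu>"
    "\<And>E. E \<in> sets M \<Longrightarrow> has_BC_integral M \<kappa> \<nu> E (BC_integral M \<nu> E)"
proof -
  obtain \<kappa> where \<kappa>: "\<kappa> \<in> NA_pos M" "BC_integrable M \<kappa> \<nu>"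
    using assms by (auto simp: BC_def)
  have "has_BC_integral M \<kappa> \<nu> E (BC_integral M \<nu> E)" if E: "E \<in> sets M" for E
  proof -
    obtain l where "has_BC_integral M \<kappa> \<nu> E l" using \<kappa> E by (auto simp: BC_integrable_def)
    then show ?thesis using BC_integral_eqI[OF \<kappa> E] by metis
  qed
  then show ?thesis using that \<kappa> by blast
qed

section \<open>The linear space of integrable games\<close>

lemma games_add: "\<nu> \<in> games M \<Longrightarrow> \<eta> \<in> games M \<Longrightarrow> (\<lambda>A. \<nu> A + \<eta> A) \<in> games M"
  and games_scale: "\<nu> \<in> games M \<Longrightarrow> (\<lambda>A. c * \<nu> A) \<in> games M"
  by (auto simp: games_def)

lemma BC_add:
  assumes "\<nu> \<in> BC M" "\<eta> \<in> BC M"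
  shows "(\<lambda>A. \<nu> A + \<eta> A) \<in> BC M"
proof -
  obtain \<kappa> where \<kappa>: "\<kappa> \<in> NA_pos M" "\<And>E. E \<in> sets M \<Longrightarrow> has_BC_integral M \<kappa> \<nu> E (BC_integral M \<nu> E)"
    using BC_obtain[OF assms(1)] by metis
  obtain \<kappa>' where \<kappa>': "\<kappa>' \<in> NA_pos M" "\<And>E. E \<in> sets M \<Longrightarrow> has_BC_integral M \<kappa>' \<eta> E (BC_integral M \<eta> E)"
    using BC_obtain[OF assms(2)] by metis
  have "BC_integrable M (\<lambda>A. \<kappa> A + \<kappa>' A) (\<lambda>A. \<nu> A + \<eta> A)"
    unfolding BC_integrable_def
    using has_BC_integral_add[OF has_BC_integral_mono[OF \<kappa>(2)] has_BC_integral_mono[OF \<kappa>'(2)],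
        where \<kappa> = "\<lambda>A. \<kappa> A + \<kappa>' A"] NA_pos_nonneg[OF \<kappa>(1)] NA_pos_nonneg[OF \<kappa>'(1)]
    by (metis le_add_same_cancel1 le_add_same_cancel2)
  then show ?thesis
    using NA_pos_add[OF \<kappa>(1) \<kappa>'(1)] games_add[OF assms[THEN BC_games]] by (auto simp: BC_def)
qed

lemma BC_scale:
  assumes "\<nu> \<in> BC M"
  shows "(\<lambda>A. c * \<nu> A) \<in> BC M"
  using assms unfolding BC_def BC_integrable_def
  by (blast intro: has_BC_integral_scale games_scale)

lemma NA_has_BC_integral: "\<mu> \<in> NA M \<Longrightarrow> has_BC_integral M \<kappa> \<mu> E (\<mu> E)"
  unfolding has_BC_integral_def by (auto simp: NA_sum_partition intro: exI[of _ 1])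

lemma NA_BC_integrable: "\<mu> \<in> NA M \<Longrightarrow> BC_integrable M \<kappa> \<mu>"
  unfolding BC_integrable_def using NA_has_BC_integral by blast

lemma NA_subset_BC: "NA M \<subseteq> BC M"
proof
  fix \<mu> assume "\<mu> \<in> NA M"
  then show "\<mu> \<in> BC M"
    \<comment> \<open>The zero measure can serve as control: the partition sums of an additive game
      all equal its value exactly.\<close>
    using NA_pos_zero[of M] NA_BC_integrable unfolding BC_def by (auto simp: NA_def)
qed

lemma BC_integral_NA:
  assumes "\<mu> \<in> NA M"
  shows "BC_integral M \<mu> = \<mu>"
proof
  fix E show "BC_integral M \<mu> E = \<mu> E"
  proof (cases "E \<in> sets M")
    case True
    then show ?thesis
      using BC_integral_eqI[OF NA_pos_zero NA_BC_integrable] NA_has_BC_integral assms by blast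
  qed (simp add: BC_integral_def NA_outside[OF assms])
qed

section \<open>Lipschitz games\<close>

text \<open>The two monotonicity conditions merge into one estimate on increments, the form in which
  sums, multiples and images of bounds are handled.\<close>

lemma lip_bound_iff:
  "lip_bound M \<mu> \<nu> \<longleftrightarrow>
     (\<forall>A\<in>sets M. \<forall>B\<in>sets M. A \<subseteq> B \<longrightarrow> \<bar>\<nu> B - \<nu> A\<bar> \<le> \<mu> B - \<mu> A)"
proof -
  have "\<bar>\<nu> B - \<nu> A\<bar> \<le> \<mu> B - \<mu> A \<longleftrightarrow>
      \<nu> A - - \<mu> A \<le> \<nu> B - - \<mu> B \<and> \<mu> A - \<nu> A \<le> \<mu> B - \<nu> B" for A B
    by linarith
  then show ?thesis unfolding lip_bound_def game_le_def monotone_game_def by blast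
qed

lemma lip_bound_add:
  "lip_bound M \<mu> \<nu> \<Longrightarrow> lip_bound M \<kappa> \<eta> \<Longrightarrow> lip_bound M (\<lambda>A. \<mu> A + \<kappa> A) (\<lambda>A. \<nu> A + \<eta> A)"
  unfolding lip_bound_iff by (smt (verit))

lemma lip_bound_scale:
  assumes "lip_bound M \<mu> \<nu>"
  shows "lip_bound M (\<lambda>A. \<bar>c\<bar> * \<mu> A) (\<lambda>A. c * \<nu> A)"
  using assms unfolding lip_bound_iff
  by (auto simp: right_diff_distrib[symmetric] abs_mult mult_left_mono)

text \<open>The bound on increments is applied from the empty set, where both functions
  vanish.\<close>

lemma lip_bound_abs_le:
  assumes "lip_bound M \<mu> \<nu>" "\<mu> \<in> NA_pos M" "\<nu> \<in> games M" "A \<in> sets M"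
  shows "\<bar>\<nu> A\<bar> \<le> \<mu> A"
  using assms(1,4) NA_empty[OF NA_pos_NA[OF assms(2)]] assms(3)
  by (force simp: lip_bound_iff games_def dest: bspec[where x = "{}"])

text \<open>Bounded variation comes for free: along a chain the increments of \<nu> are dominated by
  those of \<mu>, which telescope to the total mass.\<close>

lemma AC_infI:
  assumes "\<nu> \<in> games M" "\<mu> \<in> NA_pos M" "lip_bound M \<mu> \<nu>"
  shows "\<nu> \<in> AC_inf M"
proof -
  have "(\<Sum>i<m. \<bar>\<nu> (S (Suc i)) - \<nu> (S i)\<bar>) \<le> \<mu> (space M)"
    if S: "S 0 = {}" "S m = space M" "\<forall>i\<le>m. S i \<in> sets M" "\<forall>i<m. S i \<subseteq> S (Suc i)"
    for m :: nat and S
  proof -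
    have "(\<Sum>i<m. \<bar>\<nu> (S (Suc i)) - \<nu> (S i)\<bar>) \<le> (\<Sum>i<m. \<mu> (S (Suc i)) - \<mu> (S i))"
      using S assms(3) by (intro sum_mono) (auto simp: lip_bound_iff)
    also have "\<dots> = \<mu> (space M)"
      using S NA_empty[OF NA_pos_NA[OF assms(2)]] by (simp add: sum_lessThan_telescope[of "\<lambda>i. \<mu> (S i)"])
    finally show ?thesis .
  qed
  then show ?thesis using assms unfolding AC_inf_def BV_def by blast
qed

lemma AC_inf_games: "\<nu> \<in> AC_inf M \<Longrightarrow> \<nu> \<in> games M"
  by (auto simp: AC_inf_def BV_def)

lemma AC_inf_obtain:
  assumes "\<nu> \<in> AC_inf M"
  obtains \<mu> where "\<mu> \<in> NA_pos M" "lip_bound M \<mu> \<nu>"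
  using assms by (auto simp: AC_inf_def)

lemma AC_inf_add:
  assumes "\<nu> \<in> AC_inf M" "\<eta> \<in> AC_inf M"
  shows "(\<lambda>A. \<nu> A + \<eta> A) \<in> AC_inf M"
proof -
  obtain \<mu> \<kappa> where "\<mu> \<in> NA_pos M" "lip_bound M \<mu> \<nu>" "\<kappa> \<in> NA_pos M" "lip_bound M \<kappa> \<eta>"
    using assms by (auto simp: AC_inf_def)
  then show ?thesis
    by (intro AC_infI[OF games_add[OF assms[THEN AC_inf_games]] NA_pos_add lip_bound_add])
qed

lemma AC_inf_scale:
  assumes "\<nu> \<in> AC_inf M"
  shows "(\<lambda>A. c * \<nu> A) \<in> AC_inf M"
proof -
  obtain \<mu> where "\<mu> \<in> NA_pos M" "lip_bound M \<mu> \<nu>" using AC_inf_obtain[OF assms] .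
  then show ?thesis
    by (intro AC_infI[OF games_scale[OF AC_inf_games[OF assms]]
          NA_pos_scale[OF _ abs_ge_zero] lip_bound_scale])
qed

lemma AC_inf_diff:
  assumes "\<nu> \<in> AC_inf M" "\<eta> \<in> AC_inf M"
  shows "(\<lambda>A. \<nu> A - \<eta> A) \<in> AC_inf M"
  using AC_inf_add[OF assms(1) AC_inf_scale[OF assms(2), of "- 1"]] by simp

text \<open>For \<open>\<nu>\<close> outside \<open>AC_inf M\<close> this would fail: there \<open>norm_inf M \<nu>\<close> is the junk value \<open>Inf {}\<close>.\<close>

lemma norm_inf_less_iff:
  assumes "\<nu> \<in> AC_inf M"
  shows "norm_inf M \<nu> < \<epsilon> \<longleftrightarrow> (\<exists>\<mu>\<in>NA_pos M. lip_bound M \<mu> \<nu> \<and> \<mu> (space M) < \<epsilon>)"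
proof -
  have "{\<mu> (space M) |\<mu>. \<mu> \<in> NA_pos M \<and> lip_bound M \<mu> \<nu>} \<noteq> {}"
    using assms by (auto simp: AC_inf_def)
  moreover have "bdd_below {\<mu> (space M) |\<mu>. \<mu> \<in> NA_pos M \<and> lip_bound M \<mu> \<nu>}"
    by (intro bdd_belowI[of _ 0]) (auto simp: NA_pos_nonneg)
  ultimately show ?thesis unfolding norm_inf_def by (subst cInf_less_iff) auto
qed

text \<open>Smallness in norm becomes smallness of the values, uniformly over all measurable
  sets.\<close>

lemma norm_inf_less_abs:
  assumes "\<nu> \<in> AC_inf M" "norm_inf M \<nu> < \<epsilon>" "A \<in> sets M"
  shows "\<bar>\<nu> A\<bar> < \<epsilon>"
proof -
  obtain \<mu> where "\<mu> \<in> NA_pos M" "lip_bound M \<mu> \<nu>" "\<mu> (space M) < \<epsilon>"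
    using assms(2) norm_inf_less_iff[OF assms(1)] by auto
  then show ?thesis
    using lip_bound_abs_le[OF _ _ AC_inf_games[OF assms(1)] assms(3)] NA_pos_le_space[OF _ assms(3)]
    by fastforce
qed

text \<open>The triangle inequality is kept in strict form, so that bounding measures serve as
  witnesses and no infimum has to be attained.\<close>

lemma norm_inf_add_less:
  assumes "\<nu> \<in> AC_inf M" "\<eta> \<in> AC_inf M" "norm_inf M \<nu> < a" "norm_inf M \<eta> < b"
  shows "norm_inf M (\<lambda>A. \<nu> A + \<eta> A) < a + b"
proof -
  obtain \<mu> \<kappa> where "\<mu> \<in> NA_pos M" "lip_bound M \<mu> \<nu>" "\<mu> (space M) < a"
    "\<kappa> \<in> NA_pos M" "lip_bound M \<kappa> \<eta>" "\<kappa> (space M) < b"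
    using assms by (auto simp: norm_inf_less_iff)
  then show ?thesis
    using assms AC_inf_add
    by (subst norm_inf_less_iff)
       (auto intro!: bexI[of _ "\<lambda>A. \<mu> A + \<kappa> A"] lip_bound_add NA_pos_add)
qed

text \<open>The factor is \<open>\<bar>c\<bar> + 1\<close> so that the strict inequality survives
  \<open>c = 0\<close>.\<close>

lemma norm_inf_scale_less:
  assumes "\<nu> \<in> AC_inf M" "norm_inf M \<nu> < a"
  shows "norm_inf M (\<lambda>A. c * \<nu> A) < (\<bar>c\<bar> + 1) * a"
proof -
  obtain \<mu> where \<mu>: "\<mu> \<in> NA_pos M" "lip_bound M \<mu> \<nu>" "\<mu> (space M) < a"
    using assms by (auto simp: norm_inf_less_iff)
  have "\<bar>c\<bar> * \<mu> (space M) \<le> (\<bar>c\<bar> + 1) * \<mu> (space M)"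
    using \<mu>(1) by (intro mult_right_mono) (auto simp: NA_pos_nonneg)
  also have "\<dots> < (\<bar>c\<bar> + 1) * a" using \<mu>(3) by (intro mult_strict_left_mono) auto
  finally show ?thesis
    using assms AC_inf_scale \<mu>
    by (subst norm_inf_less_iff)
       (auto intro!: bexI[of _ "\<lambda>A. \<bar>c\<bar> * \<mu> A"] lip_bound_scale NA_pos_scale)
qed

section \<open>Closure in the Lipschitz norm\<close>

lemma norm_inf_closure_subset: "norm_inf_closure M W \<subseteq> AC_inf M"
  by (auto simp: norm_inf_closure_def)

lemma norm_inf_closure_superset:
  assumes "W \<subseteq> AC_inf M"
  shows "W \<subseteq> norm_inf_closure M W"
proof
  fix \<nu> assume "\<nu> \<in> W"
  moreover have "norm_inf M (\<lambda>A. \<nu> A - \<nu> A) < \<epsilon>" if "\<epsilon> > 0" for \<epsilon>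
  proof -
    have "(\<lambda>A. 0) \<in> AC_inf M"
      by (rule AC_infI[OF _ NA_pos_zero]) (auto simp: games_def lip_bound_iff)
    then show ?thesis
      using that by (auto simp: norm_inf_less_iff lip_bound_iff intro!: bexI[OF _ NA_pos_zero])
  qed
  ultimately show "\<nu> \<in> norm_inf_closure M W"
    using assms unfolding norm_inf_closure_def by blast
qed

lemma game_subspace_norm_inf_closure:
  assumes W: "game_subspace W" "W \<subseteq> AC_inf M"
  shows "game_subspace (norm_inf_closure M W)"
  unfolding game_subspace_def
proof (intro conjI ballI allI)
  show "(\<lambda>A. 0) \<in> norm_inf_closure M W"
    using norm_inf_closure_superset[OF W(2)] W(1) by (auto simp: game_subspace_def)
next
  fix \<nu> \<eta> assume *: "\<nu> \<in> norm_inf_closure M W" "\<eta> \<in> norm_inf_closure M W"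
  then have AC: "\<nu> \<in> AC_inf M" "\<eta> \<in> AC_inf M" using norm_inf_closure_subset by auto
  have "\<exists>\<xi>\<in>W. norm_inf M (\<lambda>A. (\<nu> A + \<eta> A) - \<xi> A) < \<epsilon>" if "\<epsilon> > 0" for \<epsilon>
  proof -
    have "\<epsilon> / 2 > 0" using that by simp
    then obtain \<nu>' \<eta>' where a: "\<nu>' \<in> W" "norm_inf M (\<lambda>A. \<nu> A - \<nu>' A) < \<epsilon> / 2"
      and b: "\<eta>' \<in> W" "norm_inf M (\<lambda>A. \<eta> A - \<eta>' A) < \<epsilon> / 2"
      using * unfolding norm_inf_closure_def by blast
    have "norm_inf M (\<lambda>A. (\<nu> A - \<nu>' A) + (\<eta> A - \<eta>' A)) < \<epsilon> / 2 + \<epsilon> / 2"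
      using a b AC W(2) by (intro norm_inf_add_less AC_inf_diff) auto
    then show ?thesis
      using a b W(1) by (intro bexI[of _ "\<lambda>A. \<nu>' A + \<eta>' A"])
        (auto simp: game_subspace_def algebra_simps)
  qed
  then show "(\<lambda>A. \<nu> A + \<eta> A) \<in> norm_inf_closure M W"
    using AC_inf_add[OF AC] by (auto simp: norm_inf_closure_def)
next
  fix c \<nu> assume *: "\<nu> \<in> norm_inf_closure M W"
  then have AC: "\<nu> \<in> AC_inf M" using norm_inf_closure_subset by auto
  have "\<exists>\<xi>\<in>W. norm_inf M (\<lambda>A. c * \<nu> A - \<xi> A) < \<epsilon>" if "\<epsilon> > 0" for \<epsilon>
  proof -
    have "\<epsilon> / (\<bar>c\<bar> + 1) > 0" using that by simp
    then obtain \<nu>' where a: "\<nu>' \<in> W" "norm_inf M (\<lambda>A. \<nu> A - \<nu>' A) < \<epsilon> / (\<bar>c\<bar> + 1)"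
      using * unfolding norm_inf_closure_def by blast
    have "norm_inf M (\<lambda>A. c * (\<nu> A - \<nu>' A)) < (\<bar>c\<bar> + 1) * (\<epsilon> / (\<bar>c\<bar> + 1))"
      using a AC W(2) by (intro norm_inf_scale_less AC_inf_diff) auto
    moreover have "(\<bar>c\<bar> + 1) * (\<epsilon> / (\<bar>c\<bar> + 1)) = \<epsilon>" by simp
    ultimately have "norm_inf M (\<lambda>A. c * \<nu> A - c * \<nu>' A) < \<epsilon>"
      by (simp add: right_diff_distrib)
    then show ?thesis
      using a W(1) by (intro bexI[of _ "\<lambda>A. c * \<nu>' A"]) (auto simp: game_subspace_def)
  qed
  then show "(\<lambda>A. c * \<nu> A) \<in> norm_inf_closure M W"
    using AC_inf_scale[OF AC] by (auto simp: norm_inf_closure_def)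
qed

section \<open>Automorphisms\<close>

lemma automorphism_inj_on: "\<theta> \<in> automorphisms M \<Longrightarrow> inj_on \<theta> (space M)"
  and automorphism_image_space: "\<theta> \<in> automorphisms M \<Longrightarrow> \<theta> ` space M = space M"
  by (auto simp: automorphisms_def bij_betw_def)

text \<open>An image under \<theta> is a preimage under its inverse, which is measurable by
  assumption.\<close>

lemma automorphism_image_sets:
  assumes "\<theta> \<in> automorphisms M" "E \<in> sets M"
  shows "\<theta> ` E \<in> sets M"
proof -
  have "the_inv_into (space M) \<theta> -` E \<inter> space M \<in> sets M"
    using assms by (auto simp: automorphisms_def intro: measurable_sets)
  moreover have "the_inv_into (space M) \<theta> -` E \<inter> space M = \<theta> ` E"
    using sets.sets_into_space[OF assms(2)] automorphism_inj_on[OF assms(1)]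
      automorphism_image_space[OF assms(1)]
    by (auto simp: the_inv_into_f_f subset_iff image_iff) (metis f_the_inv_into_f)+
  ultimately show ?thesis by simp
qed

lemma automorphism_image_Diff:
  assumes "\<theta> \<in> automorphisms M" "A \<in> sets M" "B \<in> sets M"
  shows "\<theta> ` (A - B) = \<theta> ` A - \<theta> ` B"
  using inj_on_image_set_diff[OF automorphism_inj_on[OF assms(1)], of A B] assms(2,3)[THEN sets.sets_into_space] by blast

lemma automorphism_image_preimage:
  assumes "\<theta> \<in> automorphisms M" "B \<in> sets M"
  obtains C where "C \<in> sets M" "\<theta> ` C = B" "\<And>A. A \<in> sets M \<Longrightarrow> B \<subseteq> \<theta> ` A \<Longrightarrow> C \<subseteq> A"
proof
  show "\<theta> -` B \<inter> space M \<in> sets M"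
    using assms by (auto simp: automorphisms_def intro: measurable_sets)
  show "\<theta> ` (\<theta> -` B \<inter> space M) = B"
  proof
    show "B \<subseteq> \<theta> ` (\<theta> -` B \<inter> space M)"
    proof
      fix y assume "y \<in> B"
      then have "y \<in> \<theta> ` space M"
        using sets.sets_into_space[OF assms(2)] automorphism_image_space[OF assms(1)] by auto
      then show "y \<in> \<theta> ` (\<theta> -` B \<inter> space M)" using \<open>y \<in> B\<close> by auto
    qed
  qed auto
  show "\<theta> -` B \<inter> space M \<subseteq> A" if A: "A \<in> sets M" "B \<subseteq> \<theta> ` A" for A
  proof
    fix x assume x: "x \<in> \<theta> -` B \<inter> space M"
    then obtain a where "a \<in> A" "\<theta> x = \<theta> a" using A(2) by auto
    then show "x \<in> A"
      using x sets.sets_into_space[OF A(1)] automorphism_inj_on[OF assms(1)]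
      by (metis IntD2 inj_onD subsetD)
  qed
qed

section \<open>The action of automorphisms on games\<close>

lemma push_game_eq: "E \<in> sets M \<Longrightarrow> push_game M \<theta> \<nu> E = \<nu> (\<theta> ` E)"
  by (simp add: push_game_def)

lemma push_game_games: "\<nu> \<in> games M \<Longrightarrow> push_game M \<theta> \<nu> \<in> games M"
  by (auto simp: push_game_def games_def)

lemma push_game_diff:
  "push_game M \<theta> (\<lambda>A. \<nu> A - \<eta> A) = (\<lambda>A. push_game M \<theta> \<nu> A - push_game M \<theta> \<eta> A)"
  by (auto simp: push_game_def)

lemma push_game_NA:
  assumes \<theta>: "\<theta> \<in> automorphisms M" and \<mu>: "\<mu> \<in> NA M"
  shows "push_game M \<theta> \<mu> \<in> NA M"
proof -
  have "countably_additive_game M (push_game M \<theta> \<mu>)"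
    unfolding countably_additive_game_def
  proof (intro allI impI)
    fix A :: "nat \<Rightarrow> 'a set"
    assume A: "range A \<subseteq> sets M" "disjoint_family A"
    have "range (\<lambda>n. \<theta> ` A n) \<subseteq> sets M" using A automorphism_image_sets[OF \<theta>] by auto
    moreover have "disjoint_family (\<lambda>n. \<theta> ` A n)"
      unfolding disjoint_family_on_def
    proof (intro ballI impI)
      fix m n :: nat assume "m \<noteq> n"
      have "\<theta> ` A m \<inter> \<theta> ` A n = \<theta> ` (A m \<inter> A n)"
        using A(1) sets.sets_into_space
        by (intro inj_on_image_Int[symmetric, OF automorphism_inj_on[OF \<theta>]]) auto
      then show "\<theta> ` A m \<inter> \<theta> ` A n = {}"
        using A(2) \<open>m \<noteq> n\<close> by (auto simp: disjoint_family_on_def)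
    qed
    ultimately have "(\<lambda>n. \<mu> (\<theta> ` A n)) sums \<mu> (\<Union>n. \<theta> ` A n)"
      using \<mu> by (auto simp: NA_def countably_additive_game_def)
    moreover have "(\<Union>n. A n) \<in> sets M" using A by auto
    ultimately show "(\<lambda>n. push_game M \<theta> \<mu> (A n)) sums push_game M \<theta> \<mu> (\<Union>n. A n)"
      using A by (simp add: push_game_eq image_UN range_subsetD)
  qed
  moreover have "\<not> game_atom M (push_game M \<theta> \<mu>) A" for A
  proof
    assume at: "game_atom M (push_game M \<theta> \<mu>) A"
    then have A: "A \<in> sets M" "\<mu> (\<theta> ` A) \<noteq> 0"
      by (auto simp: game_atom_def push_game_eq)
    have "\<not> game_atom M \<mu> (\<theta> ` A)" using \<mu> by (auto simp: NA_def)
    then obtain B where B: "B \<in> sets M" "B \<subseteq> \<theta> ` A" "\<mu> B \<noteq> 0" "\<mu> (\<theta> ` A - B) \<noteq> 0"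
      using A automorphism_image_sets[OF \<theta>] unfolding game_atom_def by blast
    obtain C where C: "C \<in> sets M" "\<theta> ` C = B" "C \<subseteq> A"
      using automorphism_image_preimage[OF \<theta> B(1)] A B by metis
    then have "push_game M \<theta> \<mu> C \<noteq> 0" "push_game M \<theta> \<mu> (A - C) \<noteq> 0"
      using A B automorphism_image_Diff[OF \<theta> A(1) C(1)] by (auto simp: push_game_eq)
    then show False using at C unfolding game_atom_def by blast
  qed
  ultimately show ?thesis using \<mu> push_game_games by (auto simp: NA_def)
qed

lemma push_game_NA_pos:
  assumes "\<theta> \<in> automorphisms M" "\<mu> \<in> NA_pos M"
  shows "push_game M \<theta> \<mu> \<in> NA_pos M"
  using assms push_game_NA[of \<theta> M \<mu>] NA_pos_nonneg[OF assms(2)]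
  by (auto simp: NA_pos_def push_game_eq)

lemma push_game_lip_bound:
  assumes "\<theta> \<in> automorphisms M" "lip_bound M \<mu> \<nu>"
  shows "lip_bound M (push_game M \<theta> \<mu>) (push_game M \<theta> \<nu>)"
  using assms(2) automorphism_image_sets[OF assms(1)]
  unfolding lip_bound_iff by (auto simp: push_game_eq image_mono)

lemma push_game_AC_inf:
  assumes "\<theta> \<in> automorphisms M" "\<nu> \<in> AC_inf M"
  shows "push_game M \<theta> \<nu> \<in> AC_inf M"
proof -
  obtain \<mu> where "\<mu> \<in> NA_pos M" "lip_bound M \<mu> \<nu>" using AC_inf_obtain[OF assms(2)] .
  then show ?thesis
    by (rule AC_infI[OF push_game_games[OF AC_inf_games[OF assms(2)]]
          push_game_NA_pos[OF assms(1)] push_game_lip_bound[OF assms(1)]])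
qed

text \<open>Transporting the bounding measure preserves its total mass, because \<theta> maps the
  whole space onto itself.\<close>

lemma push_game_norm_inf_less:
  assumes "\<theta> \<in> automorphisms M" "\<nu> \<in> AC_inf M" "norm_inf M \<nu> < \<epsilon>"
  shows "norm_inf M (push_game M \<theta> \<nu>) < \<epsilon>"
proof -
  obtain \<mu> where \<mu>: "\<mu> \<in> NA_pos M" "lip_bound M \<mu> \<nu>" "\<mu> (space M) < \<epsilon>"
    using assms(3) norm_inf_less_iff[OF assms(2)] by auto
  show ?thesis unfolding norm_inf_less_iff[OF push_game_AC_inf[OF assms(1,2)]]
    using \<mu> assms(1)
    by (intro bexI[of _ "push_game M \<theta> \<mu>"])
       (auto simp: push_game_eq automorphism_image_space push_game_lip_bound push_game_NA_pos)
qed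

text \<open>The injectivity on parts is what allows partition sums to be reindexed along
  \<theta>.\<close>

lemma automorphism_image_partition:
  assumes \<theta>: "\<theta> \<in> automorphisms M" and D: "D \<in> finite_partitions M E"
  shows "(`) \<theta> ` D \<in> finite_partitions M (\<theta> ` E)" "inj_on ((`) \<theta>) D"
proof -
  have s: "D \<subseteq> sets M" using D by (auto simp: finite_partitions_def)
  then have "\<Union>D \<subseteq> space M" using sets.sets_into_space by blast
  moreover have "\<Union>D = E" using D by (auto simp: finite_partitions_def partition_on_def)
  ultimately have i: "inj_on \<theta> E" using inj_on_subset[OF automorphism_inj_on[OF \<theta>]] by simp
  show "inj_on ((`) \<theta>) D"
    using i \<open>\<Union>D = E\<close> by (simp add: inj_on_image)
  have "partition_on (\<theta> ` E) ((`) \<theta> ` D)"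
  proof -
    have p: "partition_on E D" using D by (simp add: finite_partitions_def)
    then have "{} \<notin> (`) \<theta> ` D" by (auto simp: partition_on_def)
    then show ?thesis using partition_on_inj_image[OF p i] by simp
  qed
  then show "(`) \<theta> ` D \<in> finite_partitions M (\<theta> ` E)"
    using D s automorphism_image_sets[OF \<theta>] by (auto simp: finite_partitions_def)
qed

text \<open>A partition of \<open>E\<close> and its image have the same mesh and the same sum once
  measure and game are transported, so the same \<delta> works.\<close>

lemma push_game_has_BC_integral:
  assumes \<theta>: "\<theta> \<in> automorphisms M" and h: "has_BC_integral M \<kappa> \<nu> (\<theta> ` E) l"
  shows "has_BC_integral M (push_game M \<theta> \<kappa>) (push_game M \<theta> \<nu>) E l"
  unfolding has_BC_integral_def
proof (intro allI impI)
  fix \<epsilon> :: real assume "\<epsilon> > 0"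
  then obtain \<delta> where \<delta>: "\<delta> > 0"
    "\<forall>D\<in>finite_partitions M (\<theta> ` E). mesh \<kappa> D < \<delta> \<longrightarrow> \<bar>(\<Sum>I\<in>D. \<nu> I) - l\<bar> < \<epsilon>"
    using h unfolding has_BC_integral_def by blast
  show "\<exists>\<delta>>0. \<forall>D\<in>finite_partitions M E. mesh (push_game M \<theta> \<kappa>) D < \<delta> \<longrightarrow>
      \<bar>(\<Sum>I\<in>D. push_game M \<theta> \<nu> I) - l\<bar> < \<epsilon>"
  proof (intro exI[of _ \<delta>] conjI ballI impI)
    fix D assume D: "D \<in> finite_partitions M E" "mesh (push_game M \<theta> \<kappa>) D < \<delta>"
    have s: "finite D" "\<And>I. I \<in> D \<Longrightarrow> I \<in> sets M" using D(1) by (auto simp: finite_partitions_def)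
    have "mesh \<kappa> ((`) \<theta> ` D) < \<delta>"
      using D(2) s \<delta>(1) by (auto simp: mesh_less_iff push_game_eq)
    moreover have "(\<Sum>I\<in>(`) \<theta> ` D. \<nu> I) = (\<Sum>I\<in>D. push_game M \<theta> \<nu> I)"
      using s by (simp add: sum.reindex[OF automorphism_image_partition(2)[OF \<theta> D(1)]] push_game_eq)
    ultimately show "\<bar>(\<Sum>I\<in>D. push_game M \<theta> \<nu> I) - l\<bar> < \<epsilon>"
      using \<delta>(2) automorphism_image_partition(1)[OF \<theta> D(1)] by fastforce
  qed (rule \<delta>)
qed

text \<open>The transported control measure witnesses integrability, and uniqueness of the integral
  then identifies its value.\<close>

lemma
  assumes \<theta>: "\<theta> \<in> automorphisms M" and \<nu>: "\<nu> \<in> BC M"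
  shows push_game_BC: "push_game M \<theta> \<nu> \<in> BC M"
    and BC_integral_push_game: "BC_integral M (push_game M \<theta> \<nu>) = push_game M \<theta> (BC_integral M \<nu>)"
proof -
  obtain \<kappa> where \<kappa>: "\<kappa> \<in> NA_pos M"
    "\<And>E. E \<in> sets M \<Longrightarrow> has_BC_integral M \<kappa> \<nu> E (BC_integral M \<nu> E)"
    using BC_obtain[OF \<nu>] by metis
  have h: "has_BC_integral M (push_game M \<theta> \<kappa>) (push_game M \<theta> \<nu>) E (BC_integral M \<nu> (\<theta> ` E))"
    if "E \<in> sets M" for E
    using \<kappa>(2) automorphism_image_sets[OF \<theta> that] by (intro push_game_has_BC_integral[OF \<theta>])
  have i: "BC_integrable M (push_game M \<theta> \<kappa>) (push_game M \<theta> \<nu>)"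
    using h unfolding BC_integrable_def by blast
  have p: "push_game M \<theta> \<kappa> \<in> NA_pos M" by (rule push_game_NA_pos[OF \<theta> \<kappa>(1)])
  show "push_game M \<theta> \<nu> \<in> BC M"
    using i p push_game_games[OF BC_games[OF \<nu>]] by (auto simp: BC_def)
  show "BC_integral M (push_game M \<theta> \<nu>) = push_game M \<theta> (BC_integral M \<nu>)"
  proof
    fix E
    show "BC_integral M (push_game M \<theta> \<nu>) E = push_game M \<theta> (BC_integral M \<nu>) E"
      using BC_integral_eqI[OF p i _ h] by (cases "E \<in> sets M") (auto simp: push_game_def BC_integral_def)
  qed
qed

text \<open>The image of an approximating game approximates the image equally well, since the action
  is additive and does not increase the norm.\<close>

lemma push_game_norm_inf_closure:
  assumes \<theta>: "\<theta> \<in> automorphisms M" and W: "W \<subseteq> AC_inf M" "\<And>\<eta>. \<eta> \<in> W \<Longrightarrow> push_game M \<theta> \<eta> \<in> W"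
    and \<nu>: "\<nu> \<in> norm_inf_closure M W"
  shows "push_game M \<theta> \<nu> \<in> norm_inf_closure M W"
proof -
  have AC: "\<nu> \<in> AC_inf M" using \<nu> norm_inf_closure_subset by blast
  have "\<exists>\<eta>\<in>W. norm_inf M (\<lambda>A. push_game M \<theta> \<nu> A - \<eta> A) < \<epsilon>" if e: "\<epsilon> > 0" for \<epsilon>
  proof -
    obtain \<eta> where \<eta>: "\<eta> \<in> W" "norm_inf M (\<lambda>A. \<nu> A - \<eta> A) < \<epsilon>"
      using \<nu> e unfolding norm_inf_closure_def by blast
    then have "norm_inf M (push_game M \<theta> (\<lambda>A. \<nu> A - \<eta> A)) < \<epsilon>"
      using AC W(1) by (intro push_game_norm_inf_less \<theta> AC_inf_diff) auto
    then show ?thesis using W(2)[OF \<eta>(1)] by (auto simp: push_game_diff)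
  qed
  then show ?thesis using push_game_AC_inf[OF \<theta> AC] by (auto simp: norm_inf_closure_def)
qed

text \<open>Continuity yields closeness in norm; it says something about values because the images
  lie in \<open>AC_inf M\<close>, where \<open>norm_inf\<close> is a genuine infimum.\<close>

lemma norm_inf_continuous_setwise:
  assumes cont: "norm_inf_continuous_on M (AC_inf M) \<psi>"
    and into: "\<And>\<nu>. \<nu> \<in> AC_inf M \<Longrightarrow> \<psi> \<nu> \<in> AC_inf M"
    and \<nu>: "\<nu> \<in> AC_inf M" and "0 < \<epsilon>"
  shows "\<exists>\<delta>>0. \<forall>\<eta>\<in>AC_inf M. norm_inf M (\<lambda>A. \<nu> A - \<eta> A) < \<delta> \<longrightarrow>
    (\<forall>E\<in>sets M. \<bar>\<psi> \<nu> E - \<psi> \<eta> E\<bar> < \<epsilon>)"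
proof -
  obtain \<delta> where \<delta>: "\<delta> > 0" "\<forall>\<eta>\<in>AC_inf M. norm_inf M (\<lambda>A. \<eta> A - \<nu> A) < \<delta> \<longrightarrow>
      norm_inf M (\<lambda>A. \<psi> \<eta> A - \<psi> \<nu> A) < \<epsilon>"
    using cont \<nu> \<open>0 < \<epsilon>\<close> unfolding norm_inf_continuous_on_def by blast
  \<comment> \<open>Continuity and closure are defined with opposite orders of subtraction; a
    Lipschitz bound does not see the sign.\<close>
  have sym: "norm_inf M (\<lambda>A. \<eta> A - \<nu> A) = norm_inf M (\<lambda>A. \<nu> A - \<eta> A)" for \<eta>
  proof -
    have "lip_bound M \<mu> (\<lambda>A. \<eta> A - \<nu> A) = lip_bound M \<mu> (\<lambda>A. \<nu> A - \<eta> A)" for \<mu>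
      unfolding lip_bound_iff by (smt (verit))
    then show ?thesis unfolding norm_inf_def by simp
  qed
  show ?thesis
  proof (intro exI[of _ \<delta>] conjI ballI impI)
    fix \<eta> E assume "\<eta> \<in> AC_inf M" "norm_inf M (\<lambda>A. \<nu> A - \<eta> A) < \<delta>" "E \<in> sets M"
    then show "\<bar>\<psi> \<nu> E - \<psi> \<eta> E\<bar> < \<epsilon>"
      using \<delta>(2) into \<nu> norm_inf_less_abs[of "\<lambda>A. \<psi> \<eta> A - \<psi> \<nu> A" M \<epsilon> E]
      by (simp add: sym AC_inf_diff abs_minus_commute)
  qed (rule \<delta>)
qed

theorem theorem4p1:
  fixes M :: "'a measure"
    and \<psi> :: "('a set \<Rightarrow> real) \<Rightarrow> ('a set \<Rightarrow> real)"
    and Q Y :: "('a set \<Rightarrow> real) set"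
  defines "Q \<equiv> BC M \<inter> AC_inf M"
    and "Y \<equiv> norm_inf_closure M Q"
  assumes "standard_borel_space M"
    and "milnor_operator M (AC_inf M) \<psi>"
    and "norm_inf_continuous_on M (AC_inf M) \<psi>"
    and "\<forall>\<nu>\<in>Q. \<psi> \<nu> = BC_integral M \<nu>"
  shows "milnor_operator M Y \<psi> \<and> semivalue M Y \<psi>"
proof -
  have NA_AC: "NA M \<subseteq> AC_inf M" and lin: "linear_into_NA M (AC_inf M) \<psi>"
    using assms(4) by (auto simp: milnor_operator_def)
  then have \<psi>_NA: "\<psi> \<nu> \<in> NA M" if "\<nu> \<in> AC_inf M" for \<nu>
    using that by (auto simp: linear_into_NA_def)
  have QAC: "Q \<subseteq> AC_inf M" unfolding Q_def by auto
  have YAC: "Y \<subseteq> AC_inf M" unfolding Y_def by (rule norm_inf_closure_subset)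
  have QY: "Q \<subseteq> Y" unfolding Y_def by (rule norm_inf_closure_superset[OF QAC])
  have NAQ: "NA M \<subseteq> Q" using NA_AC NA_subset_BC by (auto simp: Q_def)
  have subQ: "game_subspace Q"
    using NAQ NA_pos_NA[OF NA_pos_zero] unfolding game_subspace_def Q_def
    by (auto intro: BC_add BC_scale AC_inf_add AC_inf_scale)
  have subY: "game_subspace Y" unfolding Y_def by (rule game_subspace_norm_inf_closure[OF subQ QAC])
  have linY: "linear_into_NA M Y \<psi>"
    using lin YAC by (simp add: linear_into_NA_def subset_iff)
  have pushQ: "push_game M \<theta> \<nu> \<in> Q" if "\<theta> \<in> automorphisms M" "\<nu> \<in> Q" for \<theta> \<nu>
    using that push_game_BC push_game_AC_inf by (auto simp: Q_def)
  have pushY: "push_game M \<theta> \<nu> \<in> Y" if "\<theta> \<in> automorphisms M" "\<nu> \<in> Y" for \<theta> \<nu>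
    using that push_game_norm_inf_closure[OF that(1) QAC pushQ[OF that(1)]] unfolding Y_def by simp
  have approx: "\<exists>\<delta>>0. \<forall>\<eta>\<in>AC_inf M. norm_inf M (\<lambda>A. \<nu> A - \<eta> A) < \<delta> \<longrightarrow>
      (\<forall>E\<in>sets M. \<bar>\<psi> \<nu> E - \<psi> \<eta> E\<bar> < \<epsilon>)" if "\<nu> \<in> AC_inf M" "0 < \<epsilon>" for \<nu> \<epsilon>
    using that \<psi>_NA NA_AC by (intro norm_inf_continuous_setwise[OF assms(5)]) auto
  have symm: "push_game M \<theta> (\<psi> \<nu>) = \<psi> (push_game M \<theta> \<nu>)"
    if \<theta>: "\<theta> \<in> automorphisms M" and \<nu>: "\<nu> \<in> Y" for \<theta> \<nu>
  proof
    fix E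
    have AC: "\<nu> \<in> AC_inf M" "push_game M \<theta> \<nu> \<in> AC_inf M"
      using \<nu> YAC pushY[OF \<theta>] by auto
    show "push_game M \<theta> (\<psi> \<nu>) E = \<psi> (push_game M \<theta> \<nu>) E"
    proof (cases "E \<in> sets M")
      case True
      \<comment> \<open>The two sides are compared through an integrable \<eta>, for which they
        agree; each of the two replacements of \<nu> by \<eta> costs \<epsilon>/2. The form
        \<open>0 + \<epsilon>\<close> fits \<open>field_le_epsilon\<close>.\<close>
      have "\<bar>\<psi> \<nu> (\<theta> ` E) - \<psi> (push_game M \<theta> \<nu>) E\<bar> \<le> 0 + \<epsilon>" if "0 < \<epsilon>" for \<epsilon>
      proof -
        have "0 < \<epsilon> / 2" using that by simp
        obtain \<delta>1 where 1: "\<delta>1 > 0" "\<And>\<eta> E. \<eta> \<in> AC_inf M \<Longrightarrow> norm_inf M (\<lambda>A. \<nu> A - \<eta> A) < \<delta>1 \<Longrightarrow>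
            E \<in> sets M \<Longrightarrow> \<bar>\<psi> \<nu> E - \<psi> \<eta> E\<bar> < \<epsilon> / 2"
          using approx[OF AC(1) \<open>0 < \<epsilon> / 2\<close>] by blast
        obtain \<delta>2 where 2: "\<delta>2 > 0" "\<And>\<eta> E. \<eta> \<in> AC_inf M \<Longrightarrow>
            norm_inf M (\<lambda>A. push_game M \<theta> \<nu> A - \<eta> A) < \<delta>2 \<Longrightarrow>
            E \<in> sets M \<Longrightarrow> \<bar>\<psi> (push_game M \<theta> \<nu>) E - \<psi> \<eta> E\<bar> < \<epsilon> / 2"
          using approx[OF AC(2) \<open>0 < \<epsilon> / 2\<close>] by blast
        \<comment> \<open>One \<eta> must meet the continuity bounds at \<nu> and at its image; the
          action does not enlarge the norm of the difference.\<close>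
        have "0 < min \<delta>1 \<delta>2" using 1 2 by simp
        then obtain \<eta> where \<eta>: "\<eta> \<in> Q" "norm_inf M (\<lambda>A. \<nu> A - \<eta> A) < min \<delta>1 \<delta>2"
          using \<nu> unfolding Y_def norm_inf_closure_def by blast
        have "norm_inf M (push_game M \<theta> (\<lambda>A. \<nu> A - \<eta> A)) < min \<delta>1 \<delta>2"
          using \<eta> AC QAC by (intro push_game_norm_inf_less \<theta> AC_inf_diff) auto
        then have "\<bar>\<psi> (push_game M \<theta> \<nu>) E - \<psi> (push_game M \<theta> \<eta>) E\<bar> < \<epsilon> / 2"
          using 2(2) pushQ[OF \<theta> \<eta>(1)] QAC True by (auto simp: push_game_diff)
        moreover have "\<bar>\<psi> \<nu> (\<theta> ` E) - \<psi> \<eta> (\<theta> ` E)\<bar> < \<epsilon> / 2"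
          using 1(2) \<eta> QAC automorphism_image_sets[OF \<theta> True] by auto
        moreover have "\<psi> (push_game M \<theta> \<eta>) E = \<psi> \<eta> (\<theta> ` E)"
          using assms(6) \<eta>(1) pushQ[OF \<theta> \<eta>(1)] BC_integral_push_game[OF \<theta>, of \<eta>] True
          by (auto simp: Q_def push_game_eq)
        ultimately show ?thesis by linarith
      qed
      then have "\<bar>\<psi> \<nu> (\<theta> ` E) - \<psi> (push_game M \<theta> \<nu>) E\<bar> \<le> 0" by (rule field_le_epsilon)
      then show ?thesis using True by (simp add: push_game_eq)
    \<comment> \<open>Off the measurable sets the left side is 0 by definition and the right side
      because it lies in \<open>NA M\<close>.\<close>
    qed (simp add: push_game_def NA_outside[OF \<psi>_NA[OF AC(2), unfolded push_game_def]])
  qed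
  have pos: "0 \<le> \<psi> \<nu> E" if \<nu>: "\<nu> \<in> Y" and mono: "monotone_game M \<nu>" and E: "E \<in> sets M" for \<nu> E
  proof (rule field_le_epsilon)
    fix \<epsilon> :: real assume "0 < \<epsilon>"
    then have "0 < \<epsilon> / 2" by simp
    have AC: "\<nu> \<in> AC_inf M" using \<nu> YAC by auto
    obtain \<delta> where \<delta>: "\<delta> > 0" "\<And>\<eta> E. \<eta> \<in> AC_inf M \<Longrightarrow> norm_inf M (\<lambda>A. \<nu> A - \<eta> A) < \<delta> \<Longrightarrow>
        E \<in> sets M \<Longrightarrow> \<bar>\<psi> \<nu> E - \<psi> \<eta> E\<bar> < \<epsilon> / 2"
      using approx[OF AC \<open>0 < \<epsilon> / 2\<close>] by blast
    \<comment> \<open>The bound \<delta> serves continuity of \<psi>, and \<epsilon>/2 bounds the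
      mass of the measure \<mu> controlling the difference.\<close>
    have "0 < min \<delta> (\<epsilon> / 2)" using \<delta> \<open>0 < \<epsilon>\<close> by simp
    then obtain \<eta> where \<eta>: "\<eta> \<in> Q" "norm_inf M (\<lambda>A. \<nu> A - \<eta> A) < min \<delta> (\<epsilon> / 2)"
      using \<nu> unfolding Y_def norm_inf_closure_def by blast
    have d: "(\<lambda>A. \<nu> A - \<eta> A) \<in> AC_inf M" using AC QAC \<eta> by (intro AC_inf_diff) auto
    obtain \<mu> where \<mu>: "\<mu> \<in> NA_pos M" "lip_bound M \<mu> (\<lambda>A. \<nu> A - \<eta> A)" "\<mu> (space M) < \<epsilon> / 2"
      using norm_inf_less_iff[OF d] \<eta>(2) by (meson min_less_iff_conj)
    have ge: "- \<mu> I \<le> \<eta> I" if "I \<in> sets M" for I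
    proof -
      have "\<nu> {} \<le> \<nu> I" using mono that by (auto simp: monotone_game_def)
      then have "0 \<le> \<nu> I" using AC_inf_games[OF AC] by (simp add: games_def)
      then show ?thesis
        using lip_bound_abs_le[OF \<mu>(2,1) AC_inf_games[OF d] that] by linarith
    qed
    have \<eta>BC: "\<eta> \<in> BC M" using \<eta> by (auto simp: Q_def)
    obtain \<kappa> where \<kappa>: "\<kappa> \<in> NA_pos M" "has_BC_integral M \<kappa> \<eta> E (BC_integral M \<eta> E)"
      using BC_obtain[OF \<eta>BC] E by metis
    \<comment> \<open>The lower bound for \<eta> is additive, so it sums to the same value over
      every partition and passes to the limit.\<close>
    have "- \<mu> E \<le> BC_integral M \<eta> E"
    proof (rule has_BC_integral_ge[OF \<kappa>(2,1) E])
      fix D assume D: "D \<in> finite_partitions M E"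
      have "- \<mu> E = (\<Sum>I\<in>D. - \<mu> I)"
        using NA_sum_partition[OF NA_pos_NA[OF \<mu>(1)] D] by (simp add: sum_negf)
      also have "\<dots> \<le> (\<Sum>I\<in>D. \<eta> I)"
        using D ge by (intro sum_mono) (auto simp: finite_partitions_def)
      finally show "- \<mu> E \<le> (\<Sum>I\<in>D. \<eta> I)" .
    qed
    then have "- \<mu> E \<le> \<psi> \<eta> E" using assms(6) \<eta>(1) by simp
    moreover have "\<mu> E < \<epsilon> / 2" using NA_pos_le_space[OF \<mu>(1) E] \<mu>(3) by simp
    moreover have "\<bar>\<psi> \<nu> E - \<psi> \<eta> E\<bar> < \<epsilon> / 2" using \<delta>(2) \<eta> QAC E by auto
    ultimately show "0 \<le> \<psi> \<nu> E + \<epsilon>" by linarith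
  qed
  have fixed: "\<psi> \<nu> = \<nu>" if "\<nu> \<in> NA M" for \<nu>
    using assms(6) BC_integral_NA[OF that] subsetD[OF NAQ that] by simp
  \<comment> \<open>The envelopes of a game do not depend on the domain of the operator, so their
    inequalities restrict to \<open>Y\<close>.\<close>
  have "milnor_operator M Y \<psi>"
    using assms(4) subY linY YAC NAQ QY by (auto simp: milnor_operator_def)
  moreover have "symmetric_subspace M Y"
    using subY YAC pushY by (auto simp: symmetric_subspace_def AC_inf_def)
  then have "semivalue M Y \<psi>"
    using linY symm pos fixed by (auto simp: semivalue_def)
  ultimately show ?thesis by blast
qed

end
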